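(* There is an algorithm that decides, for a given word $u\in F_2$ of length $n$, whether or not $u$ is primitivity-blocking in $F_2$, and that has worst-case time complexity $O(n^2)$.
   Context: $F_2$ is the free group of rank $2$ with fixed basis $x_1,x_2$; elements are identified with freely reduced words in $x_1^{\pm1},x_2^{\pm1}$, and lengths and subwords (contiguous) refer to these reduced words. An element of $F_2$ is primitive if it is the image of $x_1$ under some automorphism of $F_2$. A word $v$ is primitivity-blocking if for every $\varphi\in\operatorname{Aut}(F_2)$, $v$ is not a subword of the cyclic reduction of $\varphi(x_1)$; equivalently, $v$ is not a subword of any cyclically reduced primitive element of $F_2$. *)

theory Defs
  imports "HOL-Algebra.Bij" "HOL-Library.Sublist" "HOL-Library.Landau_Symbols"
begin

section \<open>The free group of rank 2\<close>

datatype gen = X1 | X2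

text \<open>The letter \<open>(g, True)\<close> is the generator \<open>g\<close>, and \<open>(g, False)\<close> is its inverse.\<close>

type_synonym letter = "gen \<times> bool"

definition inv_letter :: "letter \<Rightarrow> letter" where
  "inv_letter a = (fst a, \<not> snd a)"

definition reduced :: "letter list \<Rightarrow> bool" where
  "reduced w \<longleftrightarrow> successively (\<lambda>a b. b \<noteq> inv_letter a) w"

fun cons_cancel :: "letter \<Rightarrow> letter list \<Rightarrow> letter list" where
  "cons_cancel a [] = [a]"
| "cons_cancel a (b # w) = (if b = inv_letter a then w else a # b # w)"

definition reduce :: "letter list \<Rightarrow> letter list" where
  "reduce w = foldr cons_cancel w []"

definition F2 :: "letter list monoid" where
  "F2 = \<lparr>carrier = {w. reduced w}, mult = (\<lambda>u v. reduce (u @ v)), one = []\<rparr>"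

definition x1 :: "letter list" where
  "x1 = [(X1, True)]"

lemma inv_letter_inv_letter [simp]: "inv_letter (inv_letter a) = a"
  by (simp add: inv_letter_def)

lemma inv_letter_neq [simp]: "inv_letter a \<noteq> a" "a \<noteq> inv_letter a"
  by (auto simp: inv_letter_def prod_eq_iff)

lemma reduced_Nil [simp]: "reduced []"
  by (simp add: reduced_def)

lemma reduced_Cons:
  "reduced (a # w) \<longleftrightarrow> w = [] \<or> hd w \<noteq> inv_letter a \<and> reduced w"
  by (auto simp: reduced_def successively_Cons)

lemma reduced_cons_cancel: "reduced w \<Longrightarrow> reduced (cons_cancel a w)"
  by (cases w) (auto simp: reduced_Cons)

lemma reduced_foldr: "reduced w \<Longrightarrow> reduced (foldr cons_cancel u w)"
  by (induction u) (auto simp: reduced_cons_cancel)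

lemma reduced_reduce: "reduced (reduce w)"
  by (simp add: reduce_def reduced_foldr)

lemma reduce_id: "reduced w \<Longrightarrow> reduce w = w"
proof (induction w)
  case (Cons a w)
  then show ?case by (cases w) (auto simp: reduce_def reduced_Cons)
qed (simp add: reduce_def)

lemma cons_cancel_inverse:
  "reduced w \<Longrightarrow> cons_cancel a (cons_cancel (inv_letter a) w) = w"
  by (cases w rule: remdups_adj.cases) (auto simp: reduced_Cons)

lemma foldr_cons_cancel:
  assumes "reduced w"
  shows "foldr cons_cancel (cons_cancel a v) w = cons_cancel a (foldr cons_cancel v w)"
proof (cases v)
  case (Cons b v')
  then show ?thesis
    using cons_cancel_inverse[OF reduced_foldr[OF assms, of v'], of a] by auto
qed simp

lemma foldr_foldr_cons_cancel:
  "reduced w \<Longrightarrow>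
    foldr cons_cancel (foldr cons_cancel u v) w = foldr cons_cancel u (foldr cons_cancel v w)"
  by (induction u) (auto simp: foldr_cons_cancel)

lemma reduce_append: "reduced v \<Longrightarrow> reduce (u @ v) = foldr cons_cancel u v"
  using reduce_id[of v] by (simp add: reduce_def)

lemma foldr_map_inv:
  "reduced v \<Longrightarrow> foldr cons_cancel (rev (map inv_letter w)) (foldr cons_cancel w v) = v"
proof (induction w)
  case (Cons a w)
  then show ?case
    using cons_cancel_inverse[OF reduced_foldr[OF Cons.prems, of w], of "inv_letter a"] by simp
qed simp

theorem group_F2: "group F2"
proof (rule groupI)
  fix x y z
  assume "x \<in> carrier F2" "y \<in> carrier F2" "z \<in> carrier F2"
  then show "x \<otimes>\<^bsub>F2\<^esub> y \<otimes>\<^bsub>F2\<^esub> z = x \<otimes>\<^bsub>F2\<^esub> (y \<otimes>\<^bsub>F2\<^esub> z)"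
    by (simp add: F2_def reduce_append reduced_foldr foldr_foldr_cons_cancel)
next
  fix x
  assume x: "x \<in> carrier F2"
  let ?y = "reduce (rev (map inv_letter x))"
  have "?y \<otimes>\<^bsub>F2\<^esub> x = foldr cons_cancel (rev (map inv_letter x)) (foldr cons_cancel x [])"
    using x reduce_id[of x]
    by (simp add: F2_def reduce_append reduce_def foldr_foldr_cons_cancel)
  also have "\<dots> = \<one>\<^bsub>F2\<^esub>"
    by (simp add: foldr_map_inv F2_def)
  finally show "\<exists>y\<in>carrier F2. y \<otimes>\<^bsub>F2\<^esub> x = \<one>\<^bsub>F2\<^esub>"
    by (intro bexI[of _ ?y]) (simp_all add: F2_def reduced_reduce)
qed (auto simp: F2_def reduced_reduce reduce_id)


section \<open>Primitivity-blocking words\<close>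

text \<open>The argument is meant to be a reduced word.\<close>

function cyclic_reduction :: "letter list \<Rightarrow> letter list" where
  "cyclic_reduction w =
    (if length w \<ge> 2 \<and> hd w = inv_letter (last w)
     then cyclic_reduction (butlast (tl w)) else w)"
  by pat_completeness auto
termination
  by (relation "measure length") auto

declare cyclic_reduction.simps [simp del]

definition primitivity_blocking :: "letter list \<Rightarrow> bool" where
  "primitivity_blocking v \<longleftrightarrow> (\<forall>\<phi>\<in>auto F2. \<not> sublist v (cyclic_reduction (\<phi> x1)))"


section \<open>Multitape Turing machines\<close>

text \<open>
  Algorithms are deterministic Turing machines with finitely many two-way infinite tapes. The
  input alphabet is the (finite) type \<open>'a\<close>; an input letter \<open>a\<close> is written on the tape
  as the single symbol \<open>Input a\<close>.
\<close>

datatype 'a symbol = Blank | Input 'a | Aux nat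

datatype move = Left | Stay | Right

fun offset :: "move \<Rightarrow> int" where
  "offset Left = -1"
| "offset Stay = 0"
| "offset Right = 1"

text \<open>
  The transition function maps a state and the list of symbols under the heads to the next state
  and the list of symbols to be written and head movements, one entry per tape.
\<close>

record 'a tm =
  num_tapes :: nat
  states :: "nat set"
  symbols :: "'a symbol set"
  trans_fun :: "nat \<Rightarrow> 'a symbol list \<Rightarrow> nat \<times> ('a symbol \<times> move) list"
  start_state :: nat
  accept_state :: nat
  reject_state :: nat

definition wf_tm :: "'a tm \<Rightarrow> bool" where
  "wf_tm M \<longleftrightarrow>
     num_tapes M \<ge> 1 \<and> finite (states M) \<and> finite (symbols M) \<and>
     Blank \<in> symbols M \<and> range Input \<subseteq> symbols M \<and>
     {start_state M, accept_state M, reject_state M} \<subseteq> states M \<and>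
     accept_state M \<noteq> reject_state M \<and>
     (\<forall>q \<in> states M - {accept_state M, reject_state M}. \<forall>ss.
        length ss = num_tapes M \<and> set ss \<subseteq> symbols M \<longrightarrow>
        (case trans_fun M q ss of (q', acts) \<Rightarrow>
           q' \<in> states M \<and> length acts = num_tapes M \<and> fst ` set acts \<subseteq> symbols M))"

text \<open>A configuration is a state together with the contents and the head position of each tape.\<close>

type_synonym 'a config = "nat \<times> ((int \<Rightarrow> 'a symbol) \<times> int) list"

definition initial_tape :: "'a list \<Rightarrow> int \<Rightarrow> 'a symbol" where
  "initial_tape w i = (if 0 \<le> i \<and> i < int (length w) then Input (w ! nat i) else Blank)"

definition initial_config :: "'a tm \<Rightarrow> 'a list \<Rightarrow> 'a config" where
  "initial_config M w =
     (start_state M, (initial_tape w, 0) # replicate (num_tapes M - 1) (\<lambda>_. Blank, 0))"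

definition step :: "'a tm \<Rightarrow> 'a config \<Rightarrow> 'a config" where
  "step M = (\<lambda>(q, tps).
     if q \<in> {accept_state M, reject_state M} then (q, tps)
     else case trans_fun M q (map (\<lambda>(t, p). t p) tps) of (q', acts) \<Rightarrow>
       (q', map2 (\<lambda>(t, p) (s, m). (t(p := s), p + offset m)) tps acts))"

text \<open>
  On every input \<open>w\<close> from \<open>D\<close>, the machine gives the correct answer to the question whether
  \<open>P w\<close> holds after at most \<open>T n\<close> steps, where \<open>n\<close> is the length of \<open>w\<close>.
\<close>

definition decides_in_time ::
    "'a tm \<Rightarrow> 'a list set \<Rightarrow> ('a list \<Rightarrow> bool) \<Rightarrow> (nat \<Rightarrow> nat) \<Rightarrow> bool" where
  "decides_in_time M D P T \<longleftrightarrow>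
     (\<forall>w\<in>D. \<exists>t \<le> T (length w).
        fst ((step M ^^ t) (initial_config M w)) = (if P w then accept_state M else reject_state M))"

end

theory Submission
  imports Defs "HOL-Library.Countable"
begin

text \<open>
  Up to conjugation and the choice of the signs and names of the two generators, the primitive
  elements are the positive words obtained from \<open>X1\<close> by exchanging the generators and by the
  substitution \<open>X2 \<mapsto> X1 X2\<close>: this class is closed under the elementary Nielsen
  transformations, and by Nielsen reduction these generate the automorphism group up to inner
  automorphisms. Under the substitution, the lattice path of the word stays in a narrow strip, so
  all factors of such words are balanced: factors of equal length differ by at most 1 in their
  number of letters \<open>X1\<close>. Conversely, a balanced word can be desubstituted to a shorter
  balanced word. Hence a word is not primitivity-blocking iff it does not contain a generator with
  both signs and is balanced. Balance is tested by sliding a window of every length over the word;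
  each pass takes linear time and only needs to remember two consecutive values of the count.
\<close>

text \<open>Cyclic reductions of conjugate elements are rotations of each other, so primitive
  elements matter only up to conjugacy, and their factors are found in squares of Christoffel words.
  Automorphisms are handled as maps from letters to words that need not be reduced, and Nielsen
  reduction is an induction on the total length of the images of the two generators. The obstacle on
  this side is multiplication by an inverse generator, which creates letters of the wrong sign. It
  is absorbed either by undoing the outermost substitution of the Christoffel word, or by a
  conjugation that yields a positive word in one generator and the inverse of the other. In the
  converse direction the obstacle is that a factor may cut a block \<open>X1 X2\<close> at either
  end. The missing letter on the right has to come from a continuation of the word, so the induction
  carries the stronger claim that a balanced word can be continued arbitrarily far to the right
  inside Christoffel words.\<close>

definition inv_word :: "letter list \<Rightarrow> letter list" where
  "inv_word w = rev (map inv_letter w)"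

text \<open>Equality in the free group for words that need not be reduced. Products stay plain
  concatenations, and normal forms enter only where lengths matter.\<close>

definition eqv :: "letter list \<Rightarrow> letter list \<Rightarrow> bool" (infix "\<simeq>" 50) where
  "u \<simeq> v \<longleftrightarrow> reduce u = reduce v"

lemma inv_word_simps [simp]:
  "inv_word [] = []"
  "inv_word (x # w) = inv_word w @ [inv_letter x]"
  "inv_word (u @ v) = inv_word v @ inv_word u"
  "inv_word (inv_word w) = w"
  "length (inv_word w) = length w"
  "inv_word w = [] \<longleftrightarrow> w = []"
  by (simp_all add: inv_word_def rev_map o_def)

lemma inv_letter_eq_iff [simp]: "inv_letter x = inv_letter y \<longleftrightarrow> x = y"
  by (metis inv_letter_inv_letter)

lemma fst_inv_letter [simp]: "fst (inv_letter x) = fst x"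
  by (simp add: inv_letter_def)

lemma same_generator_iff: "fst x = fst y \<longleftrightarrow> x = y \<or> x = inv_letter y"
  by (cases x; cases y) (auto simp: inv_letter_def)

lemma eqv_refl [simp, intro]: "u \<simeq> u"
  by (simp add: eqv_def)

lemma eqv_sym: "u \<simeq> v \<Longrightarrow> v \<simeq> u"
  by (simp add: eqv_def)

lemma eqv_trans [trans]: "u \<simeq> v \<Longrightarrow> v \<simeq> w \<Longrightarrow> u \<simeq> w"
  by (simp add: eqv_def)

lemma reduce_append_foldr: "reduce (u @ v) = foldr cons_cancel u (reduce v)"
  by (simp add: reduce_def)

lemma foldr_reduce:
  "reduced w \<Longrightarrow> foldr cons_cancel (reduce u) w = foldr cons_cancel u w"
  using foldr_foldr_cons_cancel[of w u "[]"] by (simp add: reduce_def)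

lemma eqv_append: "u \<simeq> u' \<Longrightarrow> v \<simeq> v' \<Longrightarrow> u @ v \<simeq> u' @ v'"
  unfolding eqv_def reduce_append_foldr by (metis foldr_reduce reduced_reduce)

lemma eqv_reduce: "reduce u \<simeq> u"
  by (simp add: eqv_def reduce_id reduced_reduce)

lemma eqv_reduce_iff [simp]: "reduce u \<simeq> v \<longleftrightarrow> u \<simeq> v" "u \<simeq> reduce v \<longleftrightarrow> u \<simeq> v"
  by (simp_all add: eqv_def reduce_id reduced_reduce)

lemma eqv_reduced_iff: "reduced u \<Longrightarrow> reduced v \<Longrightarrow> u \<simeq> v \<longleftrightarrow> u = v"
  by (simp add: eqv_def reduce_id)

lemma eqv_Nil_iff: "u \<simeq> [] \<longleftrightarrow> reduce u = []"
  by (simp add: eqv_def reduce_id)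

lemma left_inverse: "inv_word w @ w \<simeq> []"
  using foldr_map_inv[of "[]" w] by (simp add: eqv_def reduce_def inv_word_def)

lemma right_inverse: "w @ inv_word w \<simeq> []"
  using left_inverse[of "inv_word w"] by simp

lemma cancel_left: "inv_word w @ w @ v \<simeq> v"
  using eqv_append[OF left_inverse[of w], of v v] by simp

lemma cancel_right: "w @ inv_word w @ v \<simeq> v"
  using eqv_append[OF right_inverse[of w], of v v] by simp

lemma cancel_middle: "u @ inv_word w @ w @ v \<simeq> u @ v" "u @ w @ inv_word w @ v \<simeq> u @ v"
  by (auto intro!: eqv_append cancel_left cancel_right)

lemma cancel_letter: "inv_letter x # x # v \<simeq> v" "x # inv_letter x # v \<simeq> v"
  using cancel_left[of "[x]" v] cancel_right[of "[x]" v] by simp_all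

lemma eqv_Cons: "u \<simeq> v \<Longrightarrow> x # u \<simeq> x # v"
  using eqv_append[of "[x]" "[x]" u v] by simp

lemma eqv_inv_word: assumes "u \<simeq> v" shows "inv_word u \<simeq> inv_word v"
proof -
  have "inv_word u \<simeq> inv_word u @ v @ inv_word v"
    using cancel_middle(2)[of "inv_word u" v "[]"] by (simp add: eqv_sym)
  also have "\<dots> \<simeq> inv_word u @ u @ inv_word v"
    by (intro eqv_append eqv_refl eqv_sym[OF assms])
  also have "\<dots> \<simeq> inv_word v" by (rule cancel_left)
  finally show ?thesis .
qed

lemma eqv_Nil_append: "u @ v \<simeq> [] \<Longrightarrow> v \<simeq> inv_word u"
  using eqv_append[of "inv_word u" "inv_word u" "u @ v" "[]"] cancel_left[of u v]
  by (auto intro: eqv_trans eqv_sym)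

lemma reduced_append:
  "reduced (u @ v) \<longleftrightarrow>
    reduced u \<and> reduced v \<and> (u = [] \<or> v = [] \<or> hd v \<noteq> inv_letter (last u))"
  by (auto simp: reduced_def successively_append_iff)

lemma reduced_inv_word [simp]: "reduced (inv_word w) \<longleftrightarrow> reduced w"
proof -
  have "reduced w \<Longrightarrow> reduced (inv_word w)" for w
  proof (induction w)
    case (Cons x w)
    then show ?case
      by (cases w) (auto simp: reduced_append reduced_Cons)
  qed simp
  from this[of w] this[of "inv_word w"] show ?thesis by auto
qed

lemma reduce_inv_word: "reduce (inv_word w) = inv_word (reduce w)"
  using eqv_inv_word[OF eqv_reduce[of w]]
  by (simp add: eqv_def reduce_id reduced_reduce)

lemma length_reduce_le: "length (reduce w) \<le> length w"
proof (induction w)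
  case (Cons x w)
  have "length (cons_cancel x v) \<le> Suc (length v)" for v by (cases v) auto
  then show ?case using Cons by (auto simp: reduce_def intro: le_trans)
qed (simp add: reduce_def)

definition conjugate :: "letter list \<Rightarrow> letter list \<Rightarrow> bool" where
  "conjugate u v \<longleftrightarrow> (\<exists>g. u \<simeq> g @ v @ inv_word g)"

lemma eqv_conjugate: "u \<simeq> v \<Longrightarrow> conjugate u v"
  by (auto simp: conjugate_def intro!: exI[of _ "[]"])

lemma conjugate_trans [trans]: "conjugate u v \<Longrightarrow> conjugate v w \<Longrightarrow> conjugate u w"
proof -
  assume "conjugate u v" "conjugate v w"
  then obtain g h where g: "u \<simeq> g @ v @ inv_word g" and h: "v \<simeq> h @ w @ inv_word h"
    by (auto simp: conjugate_def)
  have "g @ v @ inv_word g \<simeq> g @ (h @ w @ inv_word h) @ inv_word g"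
    by (intro eqv_append h eqv_refl)
  with g have "u \<simeq> (g @ h) @ w @ inv_word (g @ h)" by (auto intro: eqv_trans)
  then show ?thesis unfolding conjugate_def by blast
qed

lemma conjugate_sym: assumes "conjugate u v" shows "conjugate v u"
proof -
  obtain g where g: "u \<simeq> g @ v @ inv_word g" using assms by (auto simp: conjugate_def)
  have "inv_word g @ u @ g \<simeq> inv_word g @ (g @ v @ inv_word g) @ g"
    by (intro eqv_append g eqv_refl)
  also have "\<dots> \<simeq> v @ inv_word g @ g" using cancel_left[of g "v @ inv_word g @ g"] by simp
  also have "\<dots> \<simeq> v" using cancel_middle(1)[of v g "[]"] by simp
  finally have "v \<simeq> inv_word g @ u @ inv_word (inv_word g)" by (simp add: eqv_sym)
  then show ?thesis unfolding conjugate_def by blast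
qed

section \<open>Endomorphisms given on letters\<close>

abbreviation subst :: "('a \<Rightarrow> 'b list) \<Rightarrow> 'a list \<Rightarrow> 'b list" where
  "subst Y w \<equiv> concat (map Y w)"

lemma subst_subst: "subst Y (subst Z w) = subst (\<lambda>x. subst Y (Z x)) w"
  by (induction w) auto

lemma subst_map: "subst Y (map f w) = subst (\<lambda>x. Y (f x)) w"
  by (simp add: o_def)

lemma subst_singleton: "subst (\<lambda>x. [f x]) w = map f w"
  by (induction w) auto

lemma subst_cong_eqv: "(\<And>x. Y x \<simeq> Z x) \<Longrightarrow> subst Y w \<simeq> subst Z w"
  by (induction w) (auto intro: eqv_append)

lemma subst_conj:
  assumes "\<And>x. Y x \<simeq> g @ Z x @ inv_word g"
  shows "subst Y w \<simeq> g @ subst Z w @ inv_word g"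
proof (induction w)
  case Nil
  then show ?case by (simp add: eqv_sym[OF right_inverse])
next
  case (Cons x w)
  have "subst Y (x # w) \<simeq> (g @ Z x @ inv_word g) @ (g @ subst Z w @ inv_word g)"
    using eqv_append[OF assms Cons.IH] by simp
  also have "\<dots> \<simeq> g @ subst Z (x # w) @ inv_word g"
    using cancel_middle(1)[of "g @ Z x" g "subst Z w @ inv_word g"] by simp
  finally show ?case .
qed

text \<open>Under this condition \<open>subst Y\<close> respects \<open>\<simeq>\<close> and so
  induces an endomorphism of \<open>F2\<close>.\<close>

definition symmetric :: "(letter \<Rightarrow> letter list) \<Rightarrow> bool" where
  "symmetric Y \<longleftrightarrow> (\<forall>x. Y (inv_letter x) = inv_word (Y x))"

lemma subst_inv_word: "symmetric Y \<Longrightarrow> subst Y (inv_word w) = inv_word (subst Y w)"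
  by (induction w) (auto simp: symmetric_def)

lemma subst_cons_cancel:
  assumes "symmetric Y" shows "subst Y (cons_cancel x w) \<simeq> Y x @ subst Y w"
proof (cases w)
  case (Cons y v)
  have "Y (inv_letter x) = inv_word (Y x)" using assms unfolding symmetric_def by blast
  then show ?thesis
    using Cons cancel_right[of "Y x" "subst Y v"] by (auto simp: eqv_sym)
qed simp

lemma subst_reduce: "symmetric Y \<Longrightarrow> subst Y (reduce w) \<simeq> subst Y w"
proof (induction w)
  case (Cons x w)
  have "subst Y (reduce (x # w)) \<simeq> Y x @ subst Y (reduce w)"
    using subst_cons_cancel[OF Cons.prems] by (simp add: reduce_def)
  also have "\<dots> \<simeq> Y x @ subst Y w" by (intro eqv_append eqv_refl Cons)
  finally show ?case by simp
qed (simp add: reduce_def)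

lemma subst_eqv: "symmetric Y \<Longrightarrow> u \<simeq> v \<Longrightarrow> subst Y u \<simeq> subst Y v"
  by (metis subst_reduce eqv_def)

lemma subst_conjugate: "symmetric Y \<Longrightarrow> conjugate u v \<Longrightarrow> conjugate (subst Y u) (subst Y v)"
  unfolding conjugate_def
  by (metis (no_types, lifting) subst_eqv concat_append map_append subst_inv_word)

lemma symmetric_subst: "symmetric Y \<Longrightarrow> symmetric Z \<Longrightarrow> symmetric (\<lambda>x. subst Y (Z x))"
  by (simp add: symmetric_def subst_inv_word[unfolded symmetric_def])

text \<open>Trivial kernel and surjectivity of the induced endomorphism. A map on letters that is
  \<open>symmetric\<close> and \<open>bijective\<close> is the working form of an
  automorphism.\<close>

definition bijective :: "(letter \<Rightarrow> letter list) \<Rightarrow> bool" where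
  "bijective Y \<longleftrightarrow>
     (\<forall>w. subst Y w \<simeq> [] \<longrightarrow> w \<simeq> []) \<and> (\<forall>w. \<exists>v. subst Y v \<simeq> w)"

lemma inverse_imp_eqv:
  assumes "\<And>x. subst Y (Z x) \<simeq> [x]" shows "subst Y (subst Z w) \<simeq> w"
  using subst_cong_eqv[of "\<lambda>x. subst Y (Z x)" "\<lambda>x. [x]" w] assms
  by (simp add: subst_subst subst_singleton[where f = "\<lambda>x. x"])

lemma bijectiveI:
  assumes "symmetric Z" "\<And>x. subst Y (Z x) \<simeq> [x]" "\<And>x. subst Z (Y x) \<simeq> [x]"
  shows "bijective Y"
  unfolding bijective_def
proof (intro conjI allI impI)
  fix w assume "subst Y w \<simeq> []"
  then have "subst Z (subst Y w) \<simeq> subst Z []" by (rule subst_eqv[OF assms(1)])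
  then show "w \<simeq> []"
    using inverse_imp_eqv[where Y = Z and Z = Y and w = w, OF assms(3)] by (auto intro: eqv_trans eqv_sym)
next
  fix w show "\<exists>v. subst Y v \<simeq> w"
    using inverse_imp_eqv[where Y = Y and Z = Z and w = w, OF assms(2)] by (rule exI)
qed

lemma bijective_subst:
  assumes "symmetric Y" "bijective Y" "bijective Z"
  shows "bijective (\<lambda>x. subst Y (Z x))"
  unfolding bijective_def
proof (intro conjI allI impI)
  fix w assume "subst (\<lambda>x. subst Y (Z x)) w \<simeq> []"
  then have "subst Y (subst Z w) \<simeq> []" by (simp only: subst_subst)
  then show "w \<simeq> []" using assms(2,3) unfolding bijective_def by blast
next
  fix w
  obtain u where u: "subst Y u \<simeq> w" using assms(2) unfolding bijective_def by blast
  obtain v where "subst Z v \<simeq> u" using assms(3) unfolding bijective_def by blast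
  then have "subst Y (subst Z v) \<simeq> subst Y u" by (rule subst_eqv[OF assms(1)])
  then have "subst (\<lambda>x. subst Y (Z x)) v \<simeq> w"
    using eqv_trans u unfolding subst_subst by blast
  then show "\<exists>v. subst (\<lambda>x. subst Y (Z x)) v \<simeq> w" by (intro exI[of _ v])
qed

lemma bijective_conj:
  assumes "bijective Y" and Z: "\<And>x. Z x \<simeq> g @ Y x @ inv_word g"
  shows "bijective Z"
proof -
  have conj: "subst Z w \<simeq> g @ subst Y w @ inv_word g" for w
    using subst_conj[where Y = Z and Z = Y and g = g and w = w] Z by blast
  show ?thesis
    unfolding bijective_def
  proof (intro conjI allI impI)
    fix w
    assume "subst Z w \<simeq> []"
    then have "[] \<simeq> g @ subst Y w @ inv_word g"
      using conj[of w] eqv_sym eqv_trans by blast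
    then have "conjugate [] (subst Y w)"
      unfolding conjugate_def by blast
    then have "conjugate (subst Y w) []"
      by (rule conjugate_sym)
    then obtain h where "subst Y w \<simeq> h @ [] @ inv_word h"
      unfolding conjugate_def by blast
    then have "subst Y w \<simeq> []" using right_inverse[of h] by (auto intro: eqv_trans)
    then show "w \<simeq> []" using assms(1) by (simp add: bijective_def)
  next
    fix w
    obtain v where v: "subst Y v \<simeq> inv_word g @ w @ g"
      using assms(1) unfolding bijective_def by blast
    have "subst Z v \<simeq> g @ subst Y v @ inv_word g" by (rule conj)
    also have "\<dots> \<simeq> g @ (inv_word g @ w @ g) @ inv_word g" by (intro eqv_append v eqv_refl)
    also have "\<dots> \<simeq> w @ g @ inv_word g" using cancel_right[of g "w @ g @ inv_word g"] by simp
    also have "\<dots> \<simeq> w" using cancel_middle(2)[of w g "[]"] by simp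
    finally show "\<exists>v. subst Z v \<simeq> w" by (intro exI[of _ v])
  qed
qed

lemma bijective_cong: "bijective Y \<Longrightarrow> (\<And>x. Z x \<simeq> Y x) \<Longrightarrow> bijective Z"
  using bijective_conj[of Y Z "[]"] by simp

text \<open>The elementary Nielsen transformation \<open>w \<mapsto> z w\<close>. As both arguments
  are signed letters, passing \<open>inv_letter w\<close> gives multiplication from the
  right.\<close>

definition transvection :: "letter \<Rightarrow> letter \<Rightarrow> letter \<Rightarrow> letter list" where
  "transvection z w x =
     (if x = w then [z, w] else if x = inv_letter w then [inv_letter w, inv_letter z] else [x])"

lemma inv_letter_flip: "inv_letter x = y \<longleftrightarrow> x = inv_letter y"
  by auto

lemma symmetric_transvection: "symmetric (transvection z w)"
  by (auto simp: symmetric_def transvection_def inv_letter_flip)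

lemma transvection_inverse:
  assumes "fst z \<noteq> fst w"
  shows "subst (transvection z w) (transvection (inv_letter z) w x) \<simeq> [x]"
proof -
  have "z \<noteq> w" "z \<noteq> inv_letter w" "inv_letter z \<noteq> w"
    using assms by auto
  then show ?thesis
    using cancel_letter[of z "[w]"] cancel_middle(2)[of "[inv_letter w]" "[inv_letter z]" "[]"]
    by (auto simp: transvection_def)
qed

lemma bijective_transvection:
  "fst z \<noteq> fst w \<Longrightarrow> bijective (transvection z w)"
  using transvection_inverse[of z w] transvection_inverse[of "inv_letter z" w]
  by (intro bijectiveI[OF symmetric_transvection[of "inv_letter z" w]]) auto

section \<open>Christoffel words\<close>

definition swap_gens :: "gen list \<Rightarrow> gen list" where
  "swap_gens = map (case_gen X2 X1)"

definition expand :: "gen list \<Rightarrow> gen list" where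
  "expand = subst (case_gen [X1] [X1, X2])"

text \<open>
  Up to cyclic permutation, these are the Christoffel words of all rational slopes.
\<close>

inductive christoffel :: "gen list \<Rightarrow> bool" where
  single: "christoffel [X1]"
| swap: "christoffel c \<Longrightarrow> christoffel (swap_gens c)"
| expand: "christoffel c \<Longrightarrow> christoffel (expand c)"

lemma swap_gens_simps [simp]:
  "swap_gens [] = []"
  "swap_gens (x # w) = (case x of X1 \<Rightarrow> X2 | X2 \<Rightarrow> X1) # swap_gens w"
  "swap_gens (u @ v) = swap_gens u @ swap_gens v"
  "length (swap_gens w) = length w"
  by (simp_all add: swap_gens_def)

lemma swap_gens_swap_gens [simp]: "swap_gens (swap_gens c) = c"
  by (induction c) (auto split: gen.splits)

lemma expand_simps [simp]:
  "expand [] = []"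
  "expand (x # w) = (case x of X1 \<Rightarrow> [X1] | X2 \<Rightarrow> [X1, X2]) @ expand w"
  "expand (u @ v) = expand u @ expand v"
  by (simp_all add: expand_def)

text \<open>Consecutive swaps cancel, so at most one swap lies outside the last
  substitution.\<close>

lemma christoffel_cases_expand:
  assumes "christoffel c"
  obtains "c = [X1]" | "c = [X2]" | d where "christoffel d" "c = expand d"
    | d where "christoffel d" "c = swap_gens (expand d)"
proof -
  have "c = [X1] \<or> c = [X2] \<or> (\<exists>d. christoffel d \<and> (c = expand d \<or> c = swap_gens (expand d)))"
    using assms by induction auto
  then show thesis using that by blast
qed

text \<open>The invariant of Nielsen reduction. The letters \<open>x\<close> and \<open>y\<close>
  are the two generators in either order and with arbitrary signs.\<close>

definition positive_conjugate :: "letter list \<Rightarrow> bool" where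
  "positive_conjugate w \<longleftrightarrow>
     (\<exists>x y c. fst x \<noteq> fst y \<and> christoffel c \<and> conjugate w (map (case_gen x y) c))"

lemma positive_conjugate_subst_gen:
  assumes "fst x \<noteq> fst y" "christoffel c"
    and "A X1 \<simeq> h @ [x] @ inv_word h" "A X2 \<simeq> h @ [y] @ inv_word h"
  shows "positive_conjugate (subst A c)"
proof -
  have "A g \<simeq> h @ [case_gen x y g] @ inv_word h" for g
    using assms(3,4) by (cases g) auto
  then have "subst A c \<simeq> h @ subst (\<lambda>g. [case_gen x y g]) c @ inv_word h"
    by (rule subst_conj)
  then have "conjugate (subst A c) (map (case_gen x y) c)"
    unfolding subst_singleton conjugate_def by (rule exI)
  with assms(1,2) show ?thesis unfolding positive_conjugate_def by blast
qed

lemma positive_conjugate_conjugate: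
  "conjugate w v \<Longrightarrow> positive_conjugate v \<Longrightarrow> positive_conjugate w"
  unfolding positive_conjugate_def using conjugate_trans by blast

lemma conjugate_subst:
  "A X1 \<simeq> h @ B X1 @ inv_word h \<Longrightarrow> A X2 \<simeq> h @ B X2 @ inv_word h \<Longrightarrow>
    conjugate (subst A c) (subst B c)"
  unfolding conjugate_def
  by (intro exI[of _ h] subst_conj) (metis gen.exhaust)

lemma subst_swap_gens: "subst A (swap_gens c) = subst (case_gen (A X2) (A X1)) c"
  by (induction c) (auto split: gen.splits)

lemma subst_expand: "subst A (expand c) = subst (case_gen (A X1) (A X1 @ A X2)) c"
  by (induction c) (auto split: gen.splits)

lemma positive_conjugate_product:
  assumes "fst x \<noteq> fst y" "christoffel c"
  shows "positive_conjugate (subst (case_gen [x] [x, y]) c)"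
proof -
  have "subst (case_gen [x] [x, y]) c = subst (\<lambda>g. [case_gen x y g]) (expand c)"
    unfolding subst_expand by simp
  then show ?thesis
    using positive_conjugate_subst_gen[OF assms(1) christoffel.expand[OF assms(2)],
        of "\<lambda>g. [case_gen x y g]" "[]"] by simp
qed

text \<open>If \<open>c = expand d\<close>, the images \<open>x\<close> and
  \<open>inv_letter x\<close>, \<open>y\<close> of a block cancel to \<open>y\<close>, which undoes
  the expansion. If \<open>c\<close> is a swapped expansion, the letters of \<open>d\<close> go to
  \<open>inv_letter x, y\<close> and \<open>inv_letter x, y, x\<close>; conjugation by
  \<open>x\<close> turns these into \<open>y, inv_letter x\<close> and \<open>y\<close>, a positive
  substitution in \<open>y\<close> and \<open>inv_letter x\<close>.\<close>

lemma positive_conjugate_quotient: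
  assumes "fst x \<noteq> fst y" "christoffel c"
  shows "positive_conjugate (subst (case_gen [x] [inv_letter x, y]) c)"
  using assms(2)
proof (cases rule: christoffel_cases_expand)
  case 1
  then show ?thesis
    using positive_conjugate_subst_gen[OF assms(1) christoffel.single,
        of "\<lambda>g. [case_gen x y g]" "[]"] by simp
next
  case 2
  then show ?thesis
    using positive_conjugate_subst_gen[of "inv_letter x" y "expand [X2]" "\<lambda>g. [case_gen (inv_letter x) y g]" "[]"]
      assms(1) christoffel.expand[OF christoffel.swap[OF christoffel.single]] by simp
next
  case (3 d)
  have "positive_conjugate (subst (case_gen [x] [x, inv_letter x, y]) d)"
    using assms(1) 3(1) cancel_letter(2)[of x "[y]"]
    by (intro positive_conjugate_subst_gen[of x y d _ "[]"]) auto
  then show ?thesis by (simp add: 3(2) subst_expand)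
next
  case (4 d)
  let ?A = "case_gen [inv_letter x, y] [inv_letter x, y, x]"
  let ?B = "case_gen [y, inv_letter x] [y]"
  have "subst (case_gen [x] [inv_letter x, y]) c = subst ?A d"
    by (simp add: 4(2) subst_swap_gens subst_expand)
  moreover have "conjugate (subst ?A d) (subst ?B d)"
  proof (rule conjugate_subst[where h = "[inv_letter x]"])
    show "?A X1 \<simeq> [inv_letter x] @ ?B X1 @ inv_word [inv_letter x]"
      using cancel_middle(1)[of "[inv_letter x, y]" "[x]" "[]"] by (simp add: eqv_sym)
  qed simp
  moreover have "subst ?B d = subst (case_gen [y] [y, inv_letter x]) (swap_gens d)"
    by (simp add: subst_swap_gens)
  moreover have "positive_conjugate (subst (case_gen [y] [y, inv_letter x]) (swap_gens d))"
    using assms(1) by (intro positive_conjugate_product christoffel.swap 4(1)) auto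
  ultimately show ?thesis using positive_conjugate_conjugate by metis
qed

text \<open>Name the generators so that \<open>x\<close> belongs to \<open>z\<close> and
  \<open>y\<close> to \<open>w\<close>. Then \<open>x\<close> is fixed and \<open>y\<close> is
  multiplied by \<open>x\<close> or its inverse on one side. Conjugation by a power of
  \<open>x\<close> fixes \<open>x\<close> and moves the factor to the left, which leaves the product
  and the quotient substitution.\<close>

lemma positive_conjugate_transvection:
  assumes "positive_conjugate v" "fst z \<noteq> fst w"
  shows "positive_conjugate (subst (transvection z w) v)"
proof -
  obtain x y c where xyc: "fst x = fst z" "fst y = fst w" "christoffel c"
    and v: "conjugate v (map (case_gen x y) c)"
  proof -
    obtain x y c where *: "fst x \<noteq> fst y" "christoffel c" "conjugate v (map (case_gen x y) c)"
      using assms(1) unfolding positive_conjugate_def by blast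
    show thesis
    proof (cases "fst x = fst z")
      case True
      with * assms(2) have "fst y = fst w" by (metis gen.exhaust)
      with True * that show thesis by blast
    next
      case False
      then have "fst y = fst z" "fst x = fst w" using assms(2) *(1) by (metis gen.exhaust)+
      moreover have "map (case_gen y x) (swap_gens c) = map (case_gen x y) c"
        by (induction c) (auto split: gen.splits)
      ultimately show thesis using that[of y x "swap_gens c"] * christoffel.swap by simp
    qed
  qed
  define A where "A g = transvection z w (case_gen x y g)" for g
  have "conjugate (subst (transvection z w) v) (subst (transvection z w) (map (case_gen x y) c))"
    by (intro subst_conjugate symmetric_transvection v)
  also have "subst (transvection z w) (map (case_gen x y) c) = subst A c"
    unfolding A_def subst_map ..
  finally have conj: "conjugate (subst (transvection z w) v) (subst A c)" .
  have xy: "fst x \<noteq> fst y" "x \<noteq> w" "x \<noteq> inv_letter w" using assms(2) xyc by auto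
  have A1: "A X1 = [x]" using xy by (simp add: A_def transvection_def)
  have "\<exists>h B. A X1 \<simeq> h @ B X1 @ inv_word h \<and> A X2 \<simeq> h @ B X2 @ inv_word h \<and>
    (B = case_gen [x] [x, y] \<or> B = case_gen [x] [inv_letter x, y])"
  proof -
    have z: "z = x \<or> z = inv_letter x"
      using xyc same_generator_iff[of z x] by simp
    have "w = y \<or> w = inv_letter y"
      using xyc same_generator_iff[of w y] by simp
    then have "A X2 = [z, y] \<or> A X2 = [y, inv_letter z]"
      by (elim disjE) (simp_all add: A_def transvection_def)
    with z have cases: "A X2 = [x, y] \<or> A X2 = [inv_letter x, y] \<or> A X2 = [y, inv_letter x] \<or>
        A X2 = [y, x]"
      by (elim disjE) simp_all
    have eqv: "[y, x] \<simeq> [inv_letter x] @ [x, y] @ inv_word [inv_letter x]"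
      "[x] \<simeq> [inv_letter x] @ [x] @ inv_word [inv_letter x]"
      "[y, inv_letter x] \<simeq> [x] @ [inv_letter x, y] @ inv_word [x]"
      "[x] \<simeq> [x] @ [x] @ inv_word [x]"
      using cancel_letter(1)[of x "[y, x]"] cancel_letter(1)[of x "[x]"]
        cancel_letter(2)[of x "[y, inv_letter x]"] eqv_Cons[OF cancel_letter(2)[of x "[]"], of x]
      by (simp_all add: eqv_def)
    from cases show ?thesis
    proof (elim disjE)
      assume "A X2 = [x, y]"
      then show ?thesis
        using A1 by (intro exI[of _ "[]"] exI[of _ "case_gen [x] [x, y]"]) simp
    next
      assume "A X2 = [inv_letter x, y]"
      then show ?thesis
        using A1 by (intro exI[of _ "[]"] exI[of _ "case_gen [x] [inv_letter x, y]"]) simp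
    next
      assume A2: "A X2 = [y, inv_letter x]"
      show ?thesis
        unfolding A1 A2
        by (rule exI[of _ "[x]"], rule exI[of _ "case_gen [x] [inv_letter x, y]"])
          (simp only: gen.case eqv simp_thms)
    next
      assume A2: "A X2 = [y, x]"
      show ?thesis
        unfolding A1 A2
        by (rule exI[of _ "[inv_letter x]"], rule exI[of _ "case_gen [x] [x, y]"])
          (simp only: gen.case eqv simp_thms)
    qed
  qed
  then obtain h B where h: "A X1 \<simeq> h @ B X1 @ inv_word h" "A X2 \<simeq> h @ B X2 @ inv_word h"
    and B: "B = case_gen [x] [x, y] \<or> B = case_gen [x] [inv_letter x, y]" by blast
  have "positive_conjugate (subst B c)"
    using B positive_conjugate_product[OF xy(1) xyc(3)]
      positive_conjugate_quotient[OF xy(1) xyc(3)] by auto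
  moreover have "conjugate (subst A c) (subst B c)"
    by (rule conjugate_subst[where A = A and B = B, OF h])
  ultimately show ?thesis
    using conj positive_conjugate_conjugate by blast
qed

section \<open>Nielsen reduction\<close>

declare split_paired_All [simp del] split_paired_Ex [simp del]

section \<open>Common prefixes and cancellation\<close>

definition lcp :: "letter list \<Rightarrow> letter list \<Rightarrow> nat" where
  "lcp u v = length (longest_common_prefix u v)"

lemma le_lcp_iff: "k \<le> lcp u v \<longleftrightarrow> k \<le> length u \<and> k \<le> length v \<and> take k u = take k v"
proof (induction u v arbitrary: k rule: longest_common_prefix.induct)
  case (1 x u y v)
  then show ?case by (cases k) (auto simp: lcp_def)
qed (auto simp: lcp_def)

lemma lcp_take:
  "take (lcp u v) u = take (lcp u v) v" "lcp u v \<le> length u" "lcp u v \<le> length v"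
  using le_lcp_iff[of "lcp u v" u v] by auto

lemma lcp_commute: "lcp u v = lcp v u"
  using le_lcp_iff[of _ u v] le_lcp_iff[of _ v u] by (metis order_antisym order_refl)

text \<open>At the place where \<open>w\<close> leaves \<open>u\<close>, the words \<open>u\<close>
  and \<open>v\<close> still agree, so \<open>w\<close> leaves \<open>v\<close> at the same
  place.\<close>

lemma lcp_ultrametric:
  assumes "lcp w u < lcp u v" shows "lcp w v = lcp w u"
proof (rule order_antisym)
  have "lcp w v < lcp u v"
  proof (rule ccontr)
    assume "\<not> ?thesis"
    then have "take (lcp u v) w = take (lcp u v) v" "lcp u v \<le> length w"
      using le_lcp_iff[of "lcp u v" w v] by auto
    then have "lcp u v \<le> lcp w u"
      using lcp_take[of u v] by (simp add: le_lcp_iff)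
    with assms show False by simp
  qed
  then have "take (lcp w v) u = take (lcp w v) v"
    using lcp_take(1)[of u v] by (metis min.absorb1 less_imp_le take_take)
  then show "lcp w v \<le> lcp w u"
    using lcp_take[of w v] \<open>lcp w v < lcp u v\<close> lcp_take(2)[of u v] by (simp add: le_lcp_iff)
  have "take (lcp w u) u = take (lcp w u) v"
    using lcp_take(1)[of u v] assms by (metis min.absorb1 less_imp_le take_take)
  then show "lcp w u \<le> lcp w v"
    using lcp_take[of w u] assms lcp_take(3)[of u v] by (simp add: le_lcp_iff)
qed

text \<open>The first letter of \<open>u\<close> stands, inverted, next to the first letter of
  \<open>v\<close>; so cancellation consumes the common prefix and stops at the first
  difference.\<close>

lemma reduce_inv_word_append:
  assumes "reduced u" "reduced v"
  shows "reduce (inv_word u @ v) = inv_word (drop (lcp u v) u) @ drop (lcp u v) v"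
  using assms
proof (induction u v rule: longest_common_prefix.induct)
  case (1 x u y v)
  then have uv: "reduced u" "reduced v" by (auto simp: reduced_Cons)
  show ?case
  proof (cases "x = y")
    case True
    have "reduce (inv_word (x # u) @ y # v) = reduce (inv_word u @ v)"
      using cancel_middle(1)[of "inv_word u" "[x]" v] True by (simp add: eqv_def)
    then show ?thesis using 1(1)[OF True uv] True by (simp add: lcp_def)
  next
    case False
    then have "reduced (inv_word (x # u) @ y # v)"
      using 1(2,3) reduced_inv_word[of "x # u"] by (auto simp: reduced_append reduced_Cons)
    then show ?thesis using False by (simp add: lcp_def reduce_id)
  qed
qed (simp_all add: lcp_def reduce_id)

lemma length_reduce_inv_word_append:
  "reduced u \<Longrightarrow> reduced v \<Longrightarrow>
    length (reduce (inv_word u @ v)) + 2 * lcp u v = length u + length v"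
  using lcp_take(2,3)[of u v] by (simp add: reduce_inv_word_append)

lemma nth_inv_word: "i < length w \<Longrightarrow> inv_word w ! i = inv_letter (w ! (length w - Suc i))"
  by (simp add: inv_word_def rev_nth)

text \<open>An overlap of at least half would put a cancelling pair in the middle of
  \<open>u\<close> if its length is even, and a letter equal to its own inverse if it is
  odd.\<close>

lemma lcp_inv_word:
  assumes "reduced u" "u \<noteq> []" shows "2 * lcp u (inv_word u) < length u"
proof (rule ccontr)
  let ?c = "lcp u (inv_word u)" let ?n = "length u"
  assume "\<not> ?thesis"
  then have c: "?n \<le> 2 * ?c" by simp
  have sym: "u ! i = inv_letter (u ! (?n - Suc i))" if "i < ?c" for i
    using lcp_take[of u "inv_word u"] that nth_inv_word[of i u]
    by (metis nth_take order_less_le_trans)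
  have n: "?n > 0" using assms(2) by simp
  show False
  proof (cases "even ?n")
    case True
    then obtain m where "?n = 2 * m" by blast
    with n obtain j where j: "?n = 2 * Suc j" by (cases m) auto
    with c have "j < ?c" "?n - Suc j = Suc j" by auto
    then have "u ! Suc j = inv_letter (u ! j)" using sym[of j] by simp
    moreover have "u ! Suc j \<noteq> inv_letter (u ! j)"
      using assms(1) j by (auto simp: reduced_def successively_conv_nth)
    ultimately show False by simp
  next
    case False
    then obtain m where m: "?n = 2 * m + 1" by (elim oddE)
    with c have "m < ?c" "?n - Suc m = m" by auto
    then show False using sym[of m] by simp
  qed
qed

lemma inv_word_drop: "inv_word (drop k (inv_word u)) = take (length u - k) u"
  by (simp add: inv_word_def rev_map drop_map rev_drop take_map o_def)

lemma inv_word_take: "inv_word (take k (inv_word u)) = drop (length u - k) u"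
  by (simp add: inv_word_def rev_map take_map rev_take drop_map o_def)

text \<open>
  The length of a product is governed by common prefixes, which satisfy the ultrametric inequality.
  If the image of every letter is longer than the two parts cancelled on its sides, then the
  cancellation between a word and a letter in front of it only depends on the first letter.
\<close>

lemma nielsen_reduced_product:
  assumes sym: "symmetric Y" and red: "\<And>x. reduced (Y x)" and ne: "\<And>x. Y x \<noteq> []"
    and half: "\<And>x y. x \<noteq> y \<Longrightarrow> 2 * lcp (Y x) (Y y) \<le> length (Y x)"
    and triple: "\<And>k l m. k \<noteq> l \<Longrightarrow> m \<noteq> inv_letter l \<Longrightarrow>
      lcp (Y k) (Y l) + lcp (Y (inv_letter l)) (Y m) < length (Y l)"
    and "reduced (l # w)"
  shows "(\<forall>k. k \<noteq> l \<longrightarrow> lcp (Y k) (reduce (subst Y (l # w))) = lcp (Y k) (Y l) \<and>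
      lcp (Y k) (Y l) < length (reduce (subst Y (l # w)))) \<and>
    (w \<noteq> [] \<longrightarrow> length (reduce (subst Y (l # w))) \<ge> 2)"
  using \<open>reduced (l # w)\<close>
proof (induction w arbitrary: l)
  case Nil
  have "lcp (Y k) (Y l) < length (Y l)" if "k \<noteq> l" for k
    using half[OF that[symmetric]] ne[of l] lcp_commute[of "Y k" "Y l"] by (cases "Y l") auto
  then show ?case by (simp add: reduce_id red)
next
  case (Cons m w)
  define P where "P = reduce (subst Y (m # w))"
  define c where "c = lcp (Y (inv_letter l)) (Y m)"
  have ml: "m \<noteq> inv_letter l" "reduced (m # w)"
    using Cons.prems by (auto simp: reduced_Cons)
  then have P: "lcp (Y (inv_letter l)) P = c" "c < length P"
    using Cons.IH[of m] by (auto simp: P_def c_def)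
  have Yl: "Y (inv_letter l) = inv_word (Y l)" using sym unfolding symmetric_def by blast
  have "reduce (subst Y (l # m # w)) = reduce (inv_word (Y (inv_letter l)) @ P)"
    using eqv_append[OF eqv_refl[of "Y l"] eqv_reduce[of "subst Y (m # w)"]]
    by (simp add: Yl P_def eqv_def)
  also have "\<dots> = inv_word (drop c (Y (inv_letter l))) @ drop c P"
    using reduce_inv_word_append[of "Y (inv_letter l)" P] red P(1) by (simp add: P_def reduced_reduce)
  also have "\<dots> = take (length (Y l) - c) (Y l) @ drop c P"
    by (simp add: Yl inv_word_drop)
  finally have Q: "reduce (subst Y (l # m # w)) = take (length (Y l) - c) (Y l) @ drop c P"
    (is "?Q = _") .
  have "lcp (Y k) ?Q = lcp (Y k) (Y l) \<and> lcp (Y k) (Y l) < length ?Q" if "k \<noteq> l" for k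
  proof -
    \<comment> \<open>The letters of \<open>Y l\<close> that survive the cancellation on its right
      reach beyond its common prefix with \<open>Y k\<close>. So the product may replace
      \<open>Y l\<close> by the ultrametric inequality.\<close>
    have lt: "lcp (Y k) (Y l) < length (Y l) - c"
      using triple[OF that ml(1)] by (simp add: c_def)
    also have "\<dots> \<le> lcp (Y l) ?Q" unfolding le_lcp_iff Q by simp
    finally have "lcp (Y k) (Y l) < lcp (Y l) ?Q" .
    then show ?thesis
      using lcp_ultrametric[of "Y k" "Y l" ?Q] lcp_take(3)[of "Y l" ?Q] by simp
  qed
  \<comment> \<open>At least one letter of \<open>Y l\<close> and one of \<open>P\<close>
    survive.\<close>
  moreover have "length ?Q \<ge> 2"
  proof -
    have "c < length (Y l)" using triple[of "inv_letter l" l m] ml(1) by (simp add: c_def)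
    then show ?thesis using P(2) unfolding Q by simp
  qed
  ultimately show ?case by blast
qed

instance gen :: finite
  by standard (rule finite_subset[of _ "{X1, X2}"], use gen.exhaust in auto)

lemma positive_conjugate_permutation:
  assumes "symmetric Y" "\<And>x. Y x = [y x]" "inj y" "positive_conjugate w"
  shows "positive_conjugate (subst Y w)"
proof -
  obtain p q c where pq: "fst p \<noteq> fst q" "christoffel c" "conjugate w (map (case_gen p q) c)"
    using assms(4) unfolding positive_conjugate_def by blast
  have y: "y (inv_letter x) = inv_letter (y x)" for x
  proof -
    have "Y (inv_letter x) = inv_word (Y x)" using assms(1) unfolding symmetric_def by blast
    then show ?thesis by (simp add: assms(2))
  qed
  have "fst (y p) \<noteq> fst (y q)"
    using pq(1) assms(3) same_generator_iff[of "y p" "y q"] y[of q, symmetric]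
    by (auto simp: inj_eq)
  moreover have "subst Y (map (case_gen p q) c) = map (case_gen (y p) (y q)) c"
    by (induction c) (auto simp: assms(2) split: gen.splits)
  ultimately show ?thesis
    using subst_conjugate[OF assms(1) pq(3)] pq(2) unfolding positive_conjugate_def by metis
qed

text \<open>Reduced words with at least two letters have images of length at least 2. So a preimage
  of a letter is itself a letter, and finiteness makes this choice of preimages a
  permutation.\<close>

lemma nielsen_reduced_singleton:
  assumes "symmetric Y" "\<And>x. reduced (Y x)" "\<And>x. Y x \<noteq> []"
    and "\<And>x y. x \<noteq> y \<Longrightarrow> 2 * lcp (Y x) (Y y) \<le> length (Y x)"
    and "\<And>k l m. k \<noteq> l \<Longrightarrow> m \<noteq> inv_letter l \<Longrightarrow>
      lcp (Y k) (Y l) + lcp (Y (inv_letter l)) (Y m) < length (Y l)"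
    and bij: "bijective Y"
  shows "\<exists>y. (\<forall>x. Y x = [y x]) \<and> inj y"
proof -
  have "\<exists>x. Y x = [a]" for a
  proof -
    obtain v where v: "subst Y v \<simeq> [a]" using bij unfolding bijective_def by blast
    let ?v = "reduce v"
    have eq: "reduce (subst Y ?v) = [a]"
      using eqv_trans[OF subst_reduce[OF assms(1), of v] v] by (simp add: eqv_def reduce_def)
    then obtain x w where xw: "?v = x # w" by (cases ?v) (auto simp: reduce_def)
    then have "reduced (x # w)" using reduced_reduce[of v] by simp
    then have "w = []"
      using nielsen_reduced_product[OF assms(1-5), of x w] eq xw by auto
    then show ?thesis using eq xw assms(2)[of x] by (auto simp: reduce_id)
  qed
  then obtain f where f: "\<And>a. Y (f a) = [a]" by metis
  then have "inj f" by (metis injI list.inject)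
  then have "surj f" by (rule finite_UNIV_inj_surj[OF finite])
  then obtain y where y: "\<And>x. f (y x) = x" by (metis surjD)
  then have "Y x = [y x]" for x using f[of "y x"] by simp
  moreover have "inj y" using y by (metis injI)
  ultimately show ?thesis by (intro exI[of _ y] conjI allI)
qed

definition image_size :: "(letter \<Rightarrow> letter list) \<Rightarrow> nat" where
  "image_size Y = length (Y (X1, True)) + length (Y (X2, True))"

lemma image_size_eq:
  assumes "symmetric Y" "fst z \<noteq> fst w" shows "image_size Y = length (Y z) + length (Y w)"
proof -
  have len: "length (Y (g, b)) = length (Y (g, True))" for g b
  proof (cases b)
    case False
    have "Y (inv_letter (g, True)) = inv_word (Y (g, True))"
      using assms(1) unfolding symmetric_def by (rule spec)
    with False show ?thesis by (simp add: inv_letter_def)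
  qed simp
  obtain g b where "z = (g, b)" by (cases z)
  moreover obtain h b' where "w = (h, b')" by (cases w)
  ultimately show ?thesis
    using assms(2) len[of g b] len[of h b'] unfolding image_size_def
    by (cases g; cases h) auto
qed

text \<open>Up to conjugation by \<open>p\<close>, the map \<open>Y\<close> is \<open>Y'\<close>
  after the inverse transvection, and the latter preserves
  \<open>positive_conjugate\<close>.\<close>

lemma nielsen_move:
  fixes p :: "letter list"
  assumes "symmetric Y" "bijective Y" "fst z \<noteq> fst w"
  defines "Y' \<equiv> \<lambda>x. reduce (inv_word p @ subst Y (transvection z w x) @ p)"
  assumes pc: "\<And>v. positive_conjugate v \<Longrightarrow> positive_conjugate (subst Y' v)"
    and "positive_conjugate v"
  shows "positive_conjugate (subst Y v)"
proof -
  let ?v = "subst (transvection (inv_letter z) w) v"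
  have "positive_conjugate ?v"
    using assms by (intro positive_conjugate_transvection) auto
  then have "positive_conjugate (subst Y' ?v)" by (rule pc)
  moreover have "conjugate (subst Y v) (subst Y' ?v)"
  proof -
    have "conjugate (subst Y' ?v) (subst (\<lambda>x. subst Y (transvection z w x)) ?v)"
      unfolding conjugate_def
    proof (intro exI, rule subst_conj)
      fix x show "Y' x \<simeq> inv_word p @ subst Y (transvection z w x) @ inv_word (inv_word p)"
        by (simp add: Y'_def)
    qed
    also have "subst (\<lambda>x. subst Y (transvection z w x)) ?v = subst Y (subst (transvection z w) ?v)"
      by (rule subst_subst[symmetric])
    also have "conjugate \<dots> (subst Y v)"
      using transvection_inverse[OF assms(3)]
      by (intro eqv_conjugate subst_eqv[OF assms(1)] inverse_imp_eqv)
    finally show ?thesis by (rule conjugate_sym)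
  qed
  ultimately show ?thesis by (rule positive_conjugate_conjugate[rotated])
qed

text \<open>
  In rank 2 the tie in Nielsen reduction needs no ordering of words: if \<open>Y l\<close> is cancelled
  completely by its neighbours, half by half, then it is \<open>p q\<^sup>-\<^sup>1\<close> with \<open>p\<close>
  and \<open>q\<close> of equal length, and both neighbours are \<open>m\<close>, whose image has the form
  \<open>q s\<^sup>-\<^sup>1 p\<^sup>-\<^sup>1\<close>. So conjugation by \<open>p\<close> shortens the product of the
  images of \<open>l\<close> and \<open>m\<close> to \<open>s\<^sup>-\<^sup>1\<close>.
\<close>

lemma nielsen_shorten_triple:
  assumes sym: "symmetric Y" and red: "\<And>x. reduced (Y x)" and ne: "\<And>x. Y x \<noteq> []"
    and half: "\<And>x y. x \<noteq> y \<Longrightarrow> 2 * lcp (Y x) (Y y) \<le> length (Y x)"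
    and klm: "k \<noteq> l" "m \<noteq> inv_letter l"
    and ge: "length (Y l) \<le> lcp (Y k) (Y l) + lcp (Y (inv_letter l)) (Y m)"
  shows "\<exists>p. fst l \<noteq> fst m \<and> length (reduce (inv_word p @ Y l @ p)) +
    length (reduce (inv_word p @ Y l @ Y m @ p)) < length (Y l) + length (Y m)"
proof -
  have Y_inv: "Y (inv_letter x) = inv_word (Y x)" for x
    using sym unfolding symmetric_def by (rule spec)
  have half_inv: "2 * lcp (Y x) (Y (inv_letter x)) < length (Y x)" for x
    unfolding Y_inv by (intro lcp_inv_word red ne)
  define h where "h = lcp (Y k) (Y l)"
  \<comment> \<open>Each of the two overlaps is at most half of \<open>Y l\<close>, and together
    they cover it, so both are exactly half.\<close>
  have h: "length (Y l) = 2 * h" "lcp (Y (inv_letter l)) (Y m) = h" "2 * h \<le> length (Y k)"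
    using half[OF klm(1)] half[of l k] half[of "inv_letter l" m] klm ge
      lcp_commute[of "Y k" "Y l"] by (auto simp: h_def Y_inv)
  have "k \<noteq> inv_letter l" "m \<noteq> l"
    using half_inv[of l] half_inv[of "inv_letter l"] h lcp_commute[of "Y (inv_letter l)" "Y l"]
    by (auto simp: h_def)
  then have fst: "fst k \<noteq> fst l" "fst m \<noteq> fst l"
    using klm same_generator_iff by blast+
  define p where "p = take h (Y l)"
  define q where "q = take h (inv_word (Y l))"
  have p: "p = take h (Y k)"
    using lcp_take(1)[of "Y k" "Y l"] by (simp add: h_def p_def)
  have q: "q = take h (Y m)"
    using lcp_take(1)[of "Y (inv_letter l)" "Y m"] h(2) by (simp add: q_def Y_inv)
  \<comment> \<open>If \<open>m = k\<close>, then \<open>p = q\<close>, and \<open>Y l\<close> would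
    share half of its length with its inverse. In rank 2 this leaves only
    \<open>m = inv_letter k\<close>.\<close>
  have "m \<noteq> k"
  proof
    assume "m = k"
    then have "h \<le> lcp (Y l) (Y (inv_letter l))"
      using p q h(1) by (simp add: le_lcp_iff p_def q_def Y_inv)
    then show False using half_inv[of l] h(1) by simp
  qed
  then have m: "m = inv_letter k"
    using fst same_generator_iff[of m k] by (cases "fst k"; cases "fst l"; cases "fst m") auto
  have l_eq: "Y l = p @ inv_word q"
    by (simp add: p_def q_def inv_word_take h(1))
  have len: "length p = h" "length q = h" using h(1) by (auto simp: p_def q_def)
  define s where "s = drop h (take (length (Y k) - h) (Y k))"
  have k_eq: "Y k = p @ s @ inv_word q"
  proof -
    have "inv_word q = drop (length (Y k) - h) (Y k)"
      by (simp add: q m Y_inv inv_word_take)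
    moreover have "take (length (Y k) - h) (Y k) = p @ s"
      using h(3) append_take_drop_id[of h "take (length (Y k) - h) (Y k)"]
      by (simp add: s_def p min_absorb1)
    ultimately show ?thesis by (metis append_assoc append_take_drop_id)
  qed
  have "h > 0" using ne[of l] h(1) by (cases h) auto
  show ?thesis
  proof (intro exI[of _ p] conjI)
    show "fst l \<noteq> fst m" using fst(2) by simp
    have "inv_word p @ Y l @ p \<simeq> inv_word q @ p"
      using cancel_left[of p "inv_word q @ p"] by (simp add: l_eq)
    then have "length (reduce (inv_word p @ Y l @ p)) \<le> 2 * h"
      using length_reduce_le[of "inv_word q @ p"] len by (simp add: eqv_def)
    note Yl = this
    have "inv_word p @ Y l @ Y m @ p \<simeq> inv_word q @ Y m @ p"
      using cancel_left[of p "inv_word q @ Y m @ p"] by (simp add: l_eq)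
    also have "\<dots> \<simeq> inv_word s @ inv_word p @ p"
      using cancel_left[of q "inv_word s @ inv_word p @ p"] by (simp add: m Y_inv k_eq)
    also have "\<dots> \<simeq> inv_word s"
      using cancel_middle(1)[of "inv_word s" p "[]"] by simp
    finally have "length (reduce (inv_word p @ Y l @ Y m @ p)) \<le> length s"
      using length_reduce_le[of "inv_word s"] by (simp add: eqv_def)
    moreover have "length (Y m) = 2 * h + length s" using len by (simp add: m Y_inv k_eq)
    ultimately show "length (reduce (inv_word p @ Y l @ p)) +
        length (reduce (inv_word p @ Y l @ Y m @ p)) < length (Y l) + length (Y m)"
      using Yl \<open>h > 0\<close> h(1) by linarith
  qed
qed

text \<open>Induction on the total length of the images. An overlap of more than half allows an
  ordinary Nielsen move, with \<open>p\<close> empty; complete cancellation between two neighbours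
  allows a move combined with conjugation by \<open>p\<close>. If neither occurs, \<open>Y\<close>
  permutes the letters.\<close>

lemma positive_conjugate_bijective_reduced:
  assumes "symmetric Y" "bijective Y" "\<And>x. reduced (Y x)" "positive_conjugate v"
  shows "positive_conjugate (subst Y v)"
  using assms
proof (induction "image_size Y" arbitrary: Y v rule: less_induct)
  case less
  note sym = less.prems(1) and bij = less.prems(2) and red = less.prems(3)
  have Y_inv: "Y (inv_letter x) = inv_word (Y x)" for x
    using sym unfolding symmetric_def by (rule spec)
  have ne: "Y x \<noteq> []" for x
  proof
    assume "Y x = []"
    then have "subst Y [x] \<simeq> []" by simp
    then have "[x] \<simeq> []" using bij unfolding bijective_def by simp
    then show False by (simp add: eqv_def reduce_def)
  qed
  have half_inv: "2 * lcp (Y x) (Y (inv_letter x)) < length (Y x)" for x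
    unfolding Y_inv by (intro lcp_inv_word red ne)
  have move: ?case
    if zw: "fst z \<noteq> fst w"
      and lt: "length (reduce (inv_word p @ Y z @ p)) + length (reduce (inv_word p @ Y z @ Y w @ p))
        < length (Y z) + length (Y w)"
    for z w p
  proof -
    define Z where "Z x = subst Y (transvection z w x)" for x
    define Y' where "Y' x = reduce (inv_word p @ Z x @ p)" for x
    have "symmetric Z"
      unfolding Z_def by (rule symmetric_subst[OF sym symmetric_transvection])
    then have sym': "symmetric Y'"
      by (simp add: symmetric_def Y'_def flip: reduce_inv_word)
    have "bijective Z"
      unfolding Z_def by (intro bijective_subst sym bij bijective_transvection zw)
    then have bij': "bijective Y'"
      by (rule bijective_conj[where g = "inv_word p"]) (simp add: Y'_def)
    have red': "reduced (Y' x)" for x by (simp add: Y'_def reduced_reduce)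
    have "z \<noteq> w" "z \<noteq> inv_letter w" using zw by auto
    then have "Z z = Y z" "Z w = Y z @ Y w" by (simp_all add: Z_def transvection_def)
    then have "image_size Y' < image_size Y"
      using lt unfolding image_size_eq[OF sym zw] image_size_eq[OF sym' zw] by (simp add: Y'_def)
    note IH = less.hyps[OF this sym' bij' red']
    show ?thesis
      using IH less.prems(4) unfolding Y'_def Z_def
      by (rule nielsen_move[where p = p, OF sym bij zw])
  qed
  show ?case
  proof (cases "\<exists>x y. x \<noteq> y \<and> length (Y x) < 2 * lcp (Y x) (Y y)")
    case True
    then obtain x y where xy: "x \<noteq> y" "length (Y x) < 2 * lcp (Y x) (Y y)" by (elim exE conjE)
    have "y \<noteq> inv_letter x" using half_inv[of x] xy(2) by auto
    then have "fst (inv_letter x) \<noteq> fst y"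
      using xy(1) same_generator_iff[of y x] by auto
    \<comment> \<open>The move replaces \<open>Y y\<close> by the product of the inverse of
      \<open>Y x\<close> with \<open>Y y\<close>. Its length changes by
      \<open>length (Y x) - 2 * lcp (Y x) (Y y) < 0\<close>.\<close>
    then show ?thesis
      using length_reduce_inv_word_append[OF red red, of x y] xy(2) red[of x]
      by (intro move[of "inv_letter x" y "[]"]) (simp_all add: Y_inv reduce_id)
  next
    case False
    then have half: "2 * lcp (Y x) (Y y) \<le> length (Y x)" if "x \<noteq> y" for x y
      using that by (meson not_less)
    show ?thesis
    proof (cases "\<exists>k l m. k \<noteq> l \<and> m \<noteq> inv_letter l \<and>
        length (Y l) \<le> lcp (Y k) (Y l) + lcp (Y (inv_letter l)) (Y m)")
      case False
      then have triple: "lcp (Y k) (Y l) + lcp (Y (inv_letter l)) (Y m) < length (Y l)"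
        if "k \<noteq> l" "m \<noteq> inv_letter l" for k l m
        using that by (meson not_less)
      have "\<exists>y. (\<forall>x. Y x = [y x]) \<and> inj y"
        by (rule nielsen_reduced_singleton[OF sym red ne _ _ bij]) (erule half, erule (1) triple)
      then obtain y where y: "\<forall>x. Y x = [y x]" "inj y" by (elim exE conjE)
      show ?thesis by (rule positive_conjugate_permutation[OF sym spec[OF y(1)] y(2) less.prems(4)])
    next
      case True
      then obtain k l m where "k \<noteq> l" "m \<noteq> inv_letter l"
        "length (Y l) \<le> lcp (Y k) (Y l) + lcp (Y (inv_letter l)) (Y m)"
        by (elim exE conjE)
      then obtain p where p: "fst l \<noteq> fst m" "length (reduce (inv_word p @ Y l @ p)) +
          length (reduce (inv_word p @ Y l @ Y m @ p)) < length (Y l) + length (Y m)"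
        using nielsen_shorten_triple[of Y k l m] sym red ne half by auto
      show ?thesis by (rule move[OF p])
    qed
  qed
qed

theorem positive_conjugate_bijective:
  assumes "symmetric Y" "bijective Y" "positive_conjugate v"
  shows "positive_conjugate (subst Y v)"
proof -
  let ?Y = "\<lambda>x. reduce (Y x)"
  have "symmetric ?Y" using assms(1) by (simp add: symmetric_def reduce_inv_word)
  moreover have "bijective ?Y" by (rule bijective_cong[OF assms(2)]) simp
  ultimately have "positive_conjugate (subst ?Y v)"
    using assms(3) by (intro positive_conjugate_bijective_reduced) (auto simp: reduced_reduce)
  moreover have "subst Y v \<simeq> subst ?Y v" by (rule subst_cong_eqv) simp
  ultimately show ?thesis using positive_conjugate_conjugate eqv_conjugate by blast
qed

section \<open>Automorphisms of the free group\<close>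

lemma bijective_cancel: assumes "symmetric Y" "bijective Y" "subst Y u \<simeq> subst Y v" shows "u \<simeq> v"
proof -
  have "subst Y (u @ inv_word v) \<simeq> subst Y v @ inv_word (subst Y v)"
    using eqv_append[OF assms(3) eqv_refl] by (simp add: subst_inv_word[OF assms(1)])
  also have "\<dots> \<simeq> []" by (rule right_inverse)
  finally have "subst Y (u @ inv_word v) \<simeq> []" .
  then have "u @ inv_word v \<simeq> []"
    using assms(2) unfolding bijective_def by (elim conjE allE impE)
  then have "u @ inv_word v @ v \<simeq> v" using eqv_append[of "u @ inv_word v" "[]" v v] by simp
  moreover have "u @ inv_word v @ v \<simeq> u" using cancel_middle(1)[of u v "[]"] by simp
  ultimately show ?thesis by (blast intro: eqv_trans eqv_sym)
qed

text \<open>The map is restricted to the carrier because \<open>Bij\<close> contains only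
  extensional functions.\<close>

lemma bijective_auto:
  assumes "symmetric Y" "bijective Y"
  shows "(\<lambda>w\<in>carrier F2. reduce (subst Y w)) \<in> auto F2"
proof -
  let ?f = "\<lambda>w\<in>carrier F2. reduce (subst Y w)"
  have "?f \<in> hom F2 F2"
  proof (rule homI)
    fix u v assume "u \<in> carrier F2" "v \<in> carrier F2"
    moreover have "subst Y (reduce (u @ v)) \<simeq> reduce (subst Y u) @ reduce (subst Y v)"
    proof -
      have "subst Y (reduce (u @ v)) \<simeq> subst Y u @ subst Y v"
        using subst_reduce[OF assms(1), of "u @ v"] by simp
      also have "\<dots> \<simeq> reduce (subst Y u) @ reduce (subst Y v)"
        by (intro eqv_append) simp_all
      finally show ?thesis .
    qed
    ultimately show "?f (u \<otimes>\<^bsub>F2\<^esub> v) = ?f u \<otimes>\<^bsub>F2\<^esub> ?f v"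
      by (simp add: F2_def reduced_reduce eqv_def)
  qed (simp add: F2_def reduced_reduce)
  moreover have "bij_betw ?f (carrier F2) (carrier F2)"
  proof (rule bij_betw_imageI)
    show "inj_on ?f (carrier F2)"
    proof (rule inj_onI)
      fix u v assume uv: "u \<in> carrier F2" "v \<in> carrier F2" "?f u = ?f v"
      then have "subst Y u \<simeq> subst Y v" by (simp add: eqv_def)
      then have "u \<simeq> v" by (rule bijective_cancel[OF assms])
      with uv show "u = v" by (simp add: F2_def eqv_reduced_iff)
    qed
    show "?f ` carrier F2 = carrier F2"
    proof (intro equalityI subsetI)
      fix w assume w: "w \<in> carrier F2"
      obtain v where v: "subst Y v \<simeq> w" using assms(2) unfolding bijective_def by blast
      then have "subst Y (reduce v) \<simeq> w" using subst_reduce[OF assms(1)] eqv_trans by blast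
      then have "?f (reduce v) = w" "reduce v \<in> carrier F2"
        using w by (simp_all add: F2_def reduced_reduce eqv_def reduce_id)
      then show "w \<in> ?f ` carrier F2" by (metis imageI)
    qed (auto simp: F2_def reduced_reduce)
  qed
  ultimately show ?thesis by (simp add: auto_def Bij_def)
qed

lemma auto_eq_subst:
  assumes "\<phi> \<in> auto F2"
  defines "Y \<equiv> \<lambda>x. \<phi> [x]"
  shows "symmetric Y" "bijective Y" "reduced w \<Longrightarrow> reduced (\<phi> w) \<and> \<phi> w = reduce (subst Y w)"
proof -
  have hom: "\<phi> \<in> hom F2 F2" and bij: "bij_betw \<phi> (carrier F2) (carrier F2)"
    using assms(1) by (auto simp: auto_def Bij_def)
  have red: "reduced (\<phi> w)" if "reduced w" for w
    using hom that by (auto simp: hom_def F2_def)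
  have mult: "\<phi> (reduce (u @ v)) = reduce (\<phi> u @ \<phi> v)" if "reduced u" "reduced v" for u v
    using hom that by (simp add: hom_def F2_def)
  have Nil: "\<phi> [] = []"
    using hom_one[OF hom group_F2 group_F2] by (simp add: F2_def)
  have red1: "reduced [x]" for x by (simp add: reduced_Cons)
  show sym: "symmetric Y"
    unfolding symmetric_def
  proof
    fix x
    have "\<phi> [x] @ \<phi> [inv_letter x] \<simeq> []"
      using mult[of "[x]" "[inv_letter x]"] red1 Nil by (simp add: eqv_def reduce_def)
    from eqv_Nil_append[OF this] show "Y (inv_letter x) = inv_word (Y x)"
      using red red1 by (simp add: eqv_reduced_iff Y_def)
  qed
  have eq: "\<phi> w = reduce (subst Y w)" if "reduced w" for w
    using that
  proof (induction w)
    case (Cons x w)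
    then have "reduced w" by (auto simp: reduced_Cons)
    have "\<phi> (x # w) = reduce (\<phi> [x] @ \<phi> w)"
      using mult[OF red1 \<open>reduced w\<close>, of x] Cons.prems by (simp add: reduce_id)
    also have "\<dots> = reduce (\<phi> [x] @ subst Y w)"
      using Cons.IH[OF \<open>reduced w\<close>] eqv_append[OF eqv_refl eqv_reduce] unfolding eqv_def by metis
    finally show ?case by (simp add: Y_def)
  qed (simp add: Nil reduce_def)
  then show "reduced w \<Longrightarrow> reduced (\<phi> w) \<and> \<phi> w = reduce (subst Y w)" using red by blast
  have \<phi>: "\<phi> (reduce w) \<simeq> subst Y w" for w
    using subst_reduce[OF sym, of w] by (simp add: eq reduced_reduce)
  show "bijective Y"
    unfolding bijective_def
  proof (intro conjI allI impI)
    fix w assume "subst Y w \<simeq> []"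
    then have "\<phi> (reduce w) \<simeq> []" by (rule eqv_trans[OF \<phi>])
    then have "\<phi> (reduce w) = \<phi> []" using red[OF reduced_reduce] Nil by (simp add: eqv_reduced_iff)
    then have "reduce w = []"
      using bij reduced_reduce[of w] by (auto simp: bij_betw_def F2_def inj_on_def)
    then show "w \<simeq> []" by (simp add: eqv_Nil_iff)
  next
    fix w
    have "reduce w \<in> \<phi> ` carrier F2" using bij reduced_reduce[of w] by (simp add: bij_betw_def F2_def)
    then obtain v where "v \<in> carrier F2" "\<phi> v = reduce w" by force
    then have "subst Y v \<simeq> w" using \<phi>[of v] by (simp add: F2_def reduce_id eqv_def reduced_reduce)
    then show "\<exists>v. subst Y v \<simeq> w" by (rule exI[of _ v])
  qed
qed

lemma positive_conjugate_auto:
  assumes "\<phi> \<in> auto F2" shows "positive_conjugate (\<phi> x1)"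
proof -
  let ?Y = "\<lambda>x. \<phi> [x]"
  have "conjugate x1 (map (case_gen (X1, True) (X2, True)) [X1])"
    by (rule eqv_conjugate) (simp add: x1_def)
  then have "positive_conjugate x1"
    unfolding positive_conjugate_def
    by (intro exI[of _ "(X1, True)"] exI[of _ "(X2, True)"] exI[of _ "[X1]"])
      (simp add: christoffel.single)
  then have "positive_conjugate (subst ?Y x1)"
    by (intro positive_conjugate_bijective auto_eq_subst assms)
  then show ?thesis by (simp add: x1_def)
qed

section \<open>Christoffel words as images of a generator\<close>

lemma bijective_permutation:
  assumes "inj s" "\<And>x. s (inv_letter x) = inv_letter (s x)"
  shows "symmetric (\<lambda>x. [s x])" "bijective (\<lambda>x. [s x])"
proof -
  have "surj s" using assms(1) by (rule finite_UNIV_inj_surj[OF finite])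
  then obtain t where t: "\<And>x. s (t x) = x" by (metis surjD)
  then have ts: "t (s x) = x" for x using injD[OF assms(1)] by metis
  have "t (inv_letter x) = inv_letter (t x)" for x
    using assms(2)[of "t x"] t ts by metis
  then have "symmetric (\<lambda>x. [t x])" by (simp add: symmetric_def)
  then show "bijective (\<lambda>x. [s x])" by (rule bijectiveI) (simp_all add: t ts)
qed (simp add: symmetric_def assms(2))

lemma snd_inv_letter [simp]: "snd (inv_letter x) \<longleftrightarrow> \<not> snd x"
  by (simp add: inv_letter_def)

definition signed_gens :: "letter \<Rightarrow> letter \<Rightarrow> letter \<Rightarrow> letter" where
  "signed_gens x y z = (if snd z then case_gen x y (fst z) else inv_letter (case_gen x y (fst z)))"

lemma signed_gens_bijective:
  assumes "fst x \<noteq> fst y"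
  shows "symmetric (\<lambda>z. [signed_gens x y z])" "bijective (\<lambda>z. [signed_gens x y z])"
proof -
  have "inj (signed_gens x y)"
  proof (rule injI)
    fix z z' assume eq: "signed_gens x y z = signed_gens x y z'"
    then have "fst (signed_gens x y z) = fst (signed_gens x y z')" by simp
    then have "fst z = fst z'"
      using assms by (auto simp: signed_gens_def split: gen.splits if_splits)
    with eq show "z = z'"
      by (auto simp: signed_gens_def prod_eq_iff split: if_splits)
  qed
  moreover have "signed_gens x y (inv_letter z) = inv_letter (signed_gens x y z)" for z
    by (auto simp: signed_gens_def inv_letter_def)
  ultimately show "symmetric (\<lambda>z. [signed_gens x y z])" "bijective (\<lambda>z. [signed_gens x y z])"
    by (rule bijective_permutation, rule bijective_permutation(2))
qed

abbreviation pos_word :: "gen list \<Rightarrow> letter list" where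
  "pos_word \<equiv> map (\<lambda>g. (g, True))"

lemma subst_signed_gens: "subst (\<lambda>z. [signed_gens x y z]) (pos_word c) = map (case_gen x y) c"
  by (induction c) (auto simp: signed_gens_def)

text \<open>Both operations on Christoffel words come from automorphisms: exchanging the generators,
  and the transvection \<open>X2 \<mapsto> X1 X2\<close>.\<close>

lemma christoffel_bijective:
  "christoffel c \<Longrightarrow> \<exists>Y. symmetric Y \<and> bijective Y \<and> Y (X1, True) = pos_word c"
proof (induction rule: christoffel.induct)
  case single
  show ?case
    using bijective_permutation[of "\<lambda>x. x"] by (intro exI[of _ "\<lambda>x. [x]"]) simp
next
  case (swap c)
  then obtain Y where Y: "symmetric Y" "bijective Y" "Y (X1, True) = pos_word c" by blast
  let ?S = "\<lambda>z. [signed_gens (X2, True) (X1, True) z]"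
  have "symmetric ?S" "bijective ?S" by (rule signed_gens_bijective; simp)+
  moreover have "map (case_gen (X2, True) (X1, True)) c = pos_word (swap_gens c)"
    by (induction c) (auto split: gen.splits)
  then have "subst ?S (Y (X1, True)) = pos_word (swap_gens c)"
    unfolding Y(3) subst_signed_gens .
  ultimately show ?case
    using symmetric_subst[OF _ Y(1)] bijective_subst[OF _ _ Y(2)]
    by (intro exI[of _ "\<lambda>x. subst ?S (Y x)"] conjI) assumption+
next
  case (expand c)
  then obtain Y where Y: "symmetric Y" "bijective Y" "Y (X1, True) = pos_word c" by blast
  let ?T = "transvection (X1, True) (X2, True)"
  have "symmetric ?T" "bijective ?T"
    using symmetric_transvection bijective_transvection by simp_all
  moreover have "subst ?T (pos_word c) = pos_word (expand c)"
    by (induction c) (auto simp: transvection_def inv_letter_def split: gen.splits)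
  then have "subst ?T (Y (X1, True)) = pos_word (expand c)" unfolding Y(3) .
  ultimately show ?case
    using symmetric_subst[OF _ Y(1)] bijective_subst[OF _ _ Y(2)]
    by (intro exI[of _ "\<lambda>x. subst ?T (Y x)"] conjI) assumption+
qed

section \<open>Cyclic reduction\<close>

lemma sign_consistent_reduced:
  "\<forall>x\<in>set w. inv_letter x \<notin> set w \<Longrightarrow> reduced w"
proof (induction w)
  case (Cons x w)
  then have "reduced w" by simp
  moreover have "hd w \<noteq> inv_letter x" if "w \<noteq> []"
    using Cons.prems hd_in_set[OF that] by (metis list.set_intros)
  ultimately show ?case by (auto simp: reduced_Cons)
qed simp

lemma cyclic_reduction_sign_consistent:
  assumes "\<forall>x\<in>set w. inv_letter x \<notin> set w" shows "cyclic_reduction w = w"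
proof -
  have "w = [] \<or> hd w \<noteq> inv_letter (last w)" using assms by (metis hd_in_set last_in_set)
  then show ?thesis by (auto simp: cyclic_reduction.simps[of w])
qed

text \<open>If nothing cancels, the new outer pair is stripped again. Cancellation at one end only
  moves a letter from that end to the other, a rotation. Cancellation at both ends removes an outer
  pair that cyclic reduction of \<open>w\<close> would strip anyway.\<close>

lemma cyclic_reduction_conj_letter:
  assumes "reduced w"
  shows "\<exists>n. cyclic_reduction (reduce (x # w @ [inv_letter x])) = rotate n (cyclic_reduction w)"
proof -
  have inner: "cyclic_reduction (y # m @ [inv_letter y]) = cyclic_reduction m" for y m
    by (simp add: cyclic_reduction.simps[of "y # m @ [inv_letter y]"])
  have fixed: "cyclic_reduction v = v" if "v = [] \<or> hd v \<noteq> inv_letter (last v)" for v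
    using that by (auto simp: cyclic_reduction.simps[of v])
  consider "w = []" | "w \<noteq> []" "hd w \<noteq> inv_letter x" "last w \<noteq> x"
    | m where "w = inv_letter x # m" "last w \<noteq> x" | m where "w = m @ [x]" "hd w \<noteq> inv_letter x"
    | m where "w = inv_letter x # m @ [x]"
  proof (cases "w = [] \<or> hd w \<noteq> inv_letter x \<and> last w \<noteq> x")
    case True
    then show thesis using that(1,2) by blast
  next
    case False
    show thesis
    proof (cases "hd w = inv_letter x")
      case True
      then obtain m where m: "w = inv_letter x # m" using False by (cases w) auto
      show thesis
      proof (cases "last w = x")
        case True
        then have "m \<noteq> []" "last m = x" using m by (auto split: if_splits)
        then show thesis using that(5)[of "butlast m"] m by (metis append_butlast_last_id)
      qed (use m that(3) in blast)
    next
      assume hd: "hd w \<noteq> inv_letter x"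
      then have "w = butlast w @ [x]" using False by (metis append_butlast_last_id)
      then show thesis using hd that(4) by blast
    qed
  qed
  then show ?thesis
  proof cases
    case 1
    then show ?thesis by (intro exI[of _ 0]) (simp add: reduce_def)
  next
    case 2
    then have "reduced (x # w @ [inv_letter x])"
      using assms by (auto simp: reduced_Cons reduced_append)
    then show ?thesis using inner[of x w] by (intro exI[of _ 0]) (simp add: reduce_id)
  next
    case (3 m)
    then have "reduced (m @ [inv_letter x])"
      using assms by (auto simp: reduced_Cons reduced_append)
    then have "reduce (x # w @ [inv_letter x]) = m @ [inv_letter x]"
      using cancel_letter(2)[of x "m @ [inv_letter x]"] 3 by (simp add: eqv_def reduce_id)
    moreover have "cyclic_reduction (m @ [inv_letter x]) = m @ [inv_letter x]"
      using 3 assms by (intro fixed) (cases m; auto simp: reduced_Cons)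
    moreover have "cyclic_reduction w = w" using 3 by (intro fixed) auto
    ultimately show ?thesis using 3 by (intro exI[of _ 1]) simp
  next
    case (4 m)
    then have "reduced (x # m)"
      using assms by (cases m) (auto simp: reduced_Cons reduced_append)
    then have "reduce (x # w @ [inv_letter x]) = x # m"
      using cancel_middle(2)[of "x # m" "[x]" "[]"] 4 by (simp add: eqv_def reduce_id)
    moreover have "cyclic_reduction (x # m) = x # m"
      using 4 assms by (intro fixed) (cases m rule: rev_cases; auto simp: reduced_append reduced_Cons)
    moreover have "cyclic_reduction w = w" using 4 by (intro fixed) auto
    ultimately show ?thesis
      using 4 rotate_append[of m "[x]"] by (intro exI[of _ "length m"]) simp
  next
    case (5 m)
    then have "reduced m" using assms by (auto simp: reduced_Cons reduced_append)
    moreover have "x # w @ [inv_letter x] \<simeq> m"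
    proof -
      have "x # w @ [inv_letter x] \<simeq> m @ [x, inv_letter x]"
        using cancel_letter(2)[of x "m @ [x, inv_letter x]"] 5 by simp
      also have "\<dots> \<simeq> m" using cancel_middle(2)[of m "[x]" "[]"] by simp
      finally show ?thesis .
    qed
    ultimately have "reduce (x # w @ [inv_letter x]) = m" by (simp add: eqv_def reduce_id)
    moreover have "cyclic_reduction w = cyclic_reduction m"
      using inner[of "inv_letter x" m] 5 by simp
    ultimately show ?thesis by (intro exI[of _ 0]) simp
  qed
qed

lemma cyclic_reduction_conj:
  assumes "reduced w"
  shows "\<exists>n. cyclic_reduction (reduce (g @ w @ inv_word g)) = rotate n (cyclic_reduction w)"
proof (induction g)
  case Nil
  show ?case using assms by (intro exI[of _ 0]) (simp add: reduce_id)
next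
  case (Cons x g)
  let ?v = "reduce (g @ w @ inv_word g)"
  have "(x # g) @ w @ inv_word (x # g) \<simeq> x # ?v @ [inv_letter x]"
    using eqv_append[OF eqv_append[OF eqv_refl[of "[x]"] eqv_sym[OF eqv_reduce]] eqv_refl[of "[inv_letter x]"],
      of "g @ w @ inv_word g"] by simp
  then have "reduce ((x # g) @ w @ inv_word (x # g)) = reduce (x # ?v @ [inv_letter x])"
    by (simp only: eqv_def)
  then show ?case
    using cyclic_reduction_conj_letter[OF reduced_reduce, of x "g @ w @ inv_word g"] Cons.IH
      rotate_rotate by metis
qed

lemma cyclic_reduction_auto:
  assumes "\<phi> \<in> auto F2"
  obtains x y c n where "fst x \<noteq> fst y" "christoffel c"
    "cyclic_reduction (\<phi> x1) = rotate n (map (case_gen x y) c)"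
proof -
  obtain x y c where xyc: "fst x \<noteq> fst y" "christoffel c" "conjugate (\<phi> x1) (map (case_gen x y) c)"
    using positive_conjugate_auto[OF assms] unfolding positive_conjugate_def by blast
  let ?w = "map (case_gen x y) c"
  obtain g where "\<phi> x1 \<simeq> g @ ?w @ inv_word g" using xyc(3) unfolding conjugate_def by blast
  moreover have "reduced (\<phi> x1)"
    using auto_eq_subst(3)[OF assms, of x1] by (simp add: x1_def reduced_Cons)
  ultimately have "\<phi> x1 = reduce (g @ ?w @ inv_word g)" by (simp add: eqv_def reduce_id)
  moreover have "\<forall>z\<in>set ?w. inv_letter z \<notin> set ?w"
    using xyc(1) by (auto split: gen.splits)
  then have "reduced ?w" "cyclic_reduction ?w = ?w"
    by (rule sign_consistent_reduced, rule cyclic_reduction_sign_consistent)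
  then obtain n where "cyclic_reduction (reduce (g @ ?w @ inv_word g)) = rotate n ?w"
    using cyclic_reduction_conj[of ?w g] by auto
  ultimately show thesis using that[OF xyc(1,2), of n] by simp
qed


section \<open>Balanced words\<close>

definition balanced :: "gen list \<Rightarrow> bool" where
  "balanced c \<longleftrightarrow> (\<forall>u v. sublist u c \<and> sublist v c \<and> length u = length v \<longrightarrow>
     count_list u X1 \<le> Suc (count_list v X1))"

lemma count_gens: "count_list u X1 + count_list u X2 = length u"
proof (induction u)
  case (Cons g u)
  then show ?case by (cases g) auto
qed simp

lemma count_swap_gens [simp]:
  "count_list (swap_gens u) X1 = count_list u X2" "count_list (swap_gens u) X2 = count_list u X1"
  by (induction u) (auto split: gen.splits)

lemma balanced_swap_gens: assumes "balanced c" shows "balanced (swap_gens c)"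
  unfolding balanced_def
proof (intro allI impI, elim conjE)
  fix u v assume "sublist u (swap_gens c)" "sublist v (swap_gens c)" and len: "length u = length v"
  then have "sublist (swap_gens u) c" "sublist (swap_gens v) c"
    using map_mono_sublist[of _ _ "case_gen X2 X1"] by (metis swap_gens_def swap_gens_swap_gens)+
  then have "count_list (swap_gens v) X1 \<le> Suc (count_list (swap_gens u) X1)"
    using assms len unfolding balanced_def by (metis swap_gens_simps(4))
  then show "count_list u X1 \<le> Suc (count_list v X1)"
    using count_gens[of u] count_gens[of v] len by simp
qed

lemma balanced_sublist: "balanced c \<Longrightarrow> sublist d c \<Longrightarrow> balanced d"
  unfolding balanced_def by (meson sublist_order.order_trans)

text \<open>The weighted deviation of a lattice path from a line. In
  \<open>christoffel_balanced\<close> the weights become the numbers of letters \<open>X2\<close>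
  and \<open>X1\<close> of the Christoffel word, so the line joins the two ends of its path.\<close>

definition height :: "int \<Rightarrow> int \<Rightarrow> gen list \<Rightarrow> int" where
  "height \<alpha> \<beta> u = \<alpha> * int (count_list u X1) - \<beta> * int (count_list u X2)"

text \<open>
  Replacing two letters \<open>X2\<close> by \<open>X1\<close> changes the height by \<open>2 (\<alpha> + \<beta>)\<close>, which
  does not fit into the strip.
\<close>

definition strip :: "int \<Rightarrow> int \<Rightarrow> gen list \<Rightarrow> bool" where
  "strip \<alpha> \<beta> w \<longleftrightarrow> \<alpha> \<ge> 0 \<and> \<beta> \<ge> 0 \<and>
     (\<forall>p q. prefix p w \<and> prefix q w \<longrightarrow> \<bar>height \<alpha> \<beta> p - height \<alpha> \<beta> q\<bar> < \<alpha> + \<beta>)"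

lemma height_append: "height \<alpha> \<beta> (u @ v) = height \<alpha> \<beta> u + height \<alpha> \<beta> v"
  by (simp add: height_def algebra_simps)

lemma strip_balanced: assumes "strip \<alpha> \<beta> w" shows "balanced w"
  unfolding balanced_def
proof (intro allI impI, elim conjE)
  fix u v assume uv: "sublist u w" "sublist v w" and len: "length u = length v"
  have bound: "\<bar>height \<alpha> \<beta> u\<bar> < \<alpha> + \<beta>" if sub: "sublist u w" for u
  proof -
    obtain a b where "w = a @ u @ b" using sub by (auto simp: sublist_def)
    then have "prefix (a @ u) w" "prefix a w" by auto
    then have "\<bar>height \<alpha> \<beta> (a @ u) - height \<alpha> \<beta> a\<bar> < \<alpha> + \<beta>"
      using assms unfolding strip_def by blast
    then show ?thesis by (simp add: height_append)
  qed
  have eq: "height \<alpha> \<beta> u - height \<alpha> \<beta> v =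
      (\<alpha> + \<beta>) * (int (count_list u X1) - int (count_list v X1))"
  proof -
    have count: "int (count_list u X2) = int (length v) - int (count_list u X1)"
      "int (count_list v X2) = int (length v) - int (count_list v X1)"
      using count_gens[of u] count_gens[of v] len by linarith+
    show ?thesis unfolding height_def count by (simp add: algebra_simps)
  qed
  have "(\<alpha> + \<beta>) * (int (count_list u X1) - int (count_list v X1)) < (\<alpha> + \<beta>) * 2"
    using bound[OF uv(1)] bound[OF uv(2)] unfolding eq[symmetric] mult_2_right by linarith
  moreover have "\<alpha> + \<beta> \<ge> 0" using assms by (simp add: strip_def)
  ultimately have "int (count_list u X1) - int (count_list v X1) < 2"
    by (rule mult_left_less_imp_less)
  then show "count_list u X1 \<le> Suc (count_list v X1)" by linarith
qed

lemma prefix_expand: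
  "prefix p (expand w) \<Longrightarrow> \<exists>q. prefix q w \<and> (p = expand q \<or> p = expand q @ [X1])"
proof (induction w arbitrary: p)
  case Nil
  then show ?case by auto
next
  case (Cons g w)
  show ?case
  proof (cases "p = [] \<or> p = [X1]")
    case True
    then show ?thesis by (intro exI[of _ "[]"]) auto
  next
    case False
    then obtain r where r: "p = expand [g] @ r" "prefix r (expand w)"
      using Cons.prems by (cases g) (auto simp: prefix_Cons)
    then obtain q where "prefix q w" "r = expand q \<or> r = expand q @ [X1]"
      using Cons.IH by blast
    with r show ?thesis by (intro exI[of _ "g # q"]) auto
  qed
qed

text \<open>With the new weights the block \<open>X1 X2\<close> has height
  \<open>\<alpha> - (\<alpha> + \<beta>) = - \<beta>\<close>, the old height of
  \<open>X2\<close>.\<close>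

lemma height_expand: "height \<alpha> (\<alpha> + \<beta>) (expand u) = height \<alpha> \<beta> u"
proof -
  have "count_list (expand u) X1 = count_list u X1 + count_list u X2"
    "count_list (expand u) X2 = count_list u X2"
    by (induction u) (auto split: gen.splits)
  then show ?thesis by (simp add: height_def algebra_simps)
qed

text \<open>A prefix of the expansion is an expanded prefix, possibly followed by one more
  \<open>X1\<close>. This raises heights by at most \<alpha>, which is also the amount by which the
  strip widens.\<close>

lemma strip_expand: assumes "strip \<alpha> \<beta> w" shows "strip \<alpha> (\<alpha> + \<beta>) (expand w)"
proof -
  let ?h = "height \<alpha> (\<alpha> + \<beta>)"
  have step: "\<exists>q. prefix q w \<and> (?h p = height \<alpha> \<beta> q \<or> ?h p = height \<alpha> \<beta> q + \<alpha>)"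
    if p: "prefix p (expand w)" for p
  proof -
    obtain q where "prefix q w" "p = expand q \<or> p = expand q @ [X1]"
      using prefix_expand[OF p] by blast
    moreover have "?h [X1] = \<alpha>" by (simp add: height_def)
    ultimately show ?thesis by (intro exI[of _ q]) (auto simp: height_append height_expand)
  qed
  have nonneg: "\<alpha> \<ge> 0" "\<beta> \<ge> 0" using assms by (auto simp: strip_def)
  have "\<bar>?h p - ?h q\<bar> < \<alpha> + (\<alpha> + \<beta>)" if pq: "prefix p (expand w)" "prefix q (expand w)" for p q
  proof -
    obtain p' q' where "prefix p' w" "?h p = height \<alpha> \<beta> p' \<or> ?h p = height \<alpha> \<beta> p' + \<alpha>"
      "prefix q' w" "?h q = height \<alpha> \<beta> q' \<or> ?h q = height \<alpha> \<beta> q' + \<alpha>"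
      using step[OF pq(1)] step[OF pq(2)] by blast
    moreover from this have "\<bar>height \<alpha> \<beta> p' - height \<alpha> \<beta> q'\<bar> < \<alpha> + \<beta>"
      using assms unfolding strip_def by blast
    ultimately show ?thesis using nonneg by linarith
  qed
  with nonneg show ?thesis by (simp add: strip_def)
qed

lemma strip_swap_gens: assumes "strip \<alpha> \<beta> w" shows "strip \<beta> \<alpha> (swap_gens w)"
proof -
  have "\<bar>height \<beta> \<alpha> p - height \<beta> \<alpha> q\<bar> < \<beta> + \<alpha>"
    if "prefix p (swap_gens w)" "prefix q (swap_gens w)" for p q
  proof -
    have "prefix (swap_gens p) w" "prefix (swap_gens q) w"
      using that map_mono_prefix[of _ "swap_gens w" "case_gen X2 X1"]
      by (metis swap_gens_def swap_gens_swap_gens)+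
    then have "\<bar>height \<alpha> \<beta> (swap_gens p) - height \<alpha> \<beta> (swap_gens q)\<bar> < \<alpha> + \<beta>"
      using assms unfolding strip_def by blast
    then show ?thesis by (simp add: height_def)
  qed
  then show ?thesis using assms by (simp add: strip_def)
qed

text \<open>The word is doubled because all rotations of \<open>c\<close> are factors of
  \<open>c @ c\<close>. The induction starts from weights 0 and 1, for which all prefixes of
  \<open>[X1, X1]\<close> have height 0.\<close>

lemma christoffel_balanced: assumes "christoffel c" shows "balanced (c @ c)"
proof -
  have "\<exists>\<alpha> \<beta>. strip \<alpha> \<beta> (c @ c)"
    using assms
  proof induction
    case single
    show ?case
      by (intro exI[of _ 0] exI[of _ 1]) (auto simp: strip_def height_def prefix_Cons)
  next
    case (swap c)
    then show ?case using strip_swap_gens by (metis swap_gens_simps(3))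
  next
    case (expand c)
    then show ?case using strip_expand by (metis expand_simps(3))
  qed
  then show ?thesis using strip_balanced by blast
qed

lemma sublist_rotate: "sublist (rotate n w) (w @ w)"
proof -
  obtain a b where "w = a @ b" "rotate n w = b @ a"
    by (metis append_take_drop_id rotate_drop_take)
  then show ?thesis by (auto simp: sublist_def)
qed

lemma not_primitivity_blocking_imp:
  assumes "\<not> primitivity_blocking v"
  shows "\<forall>x\<in>set v. inv_letter x \<notin> set v" "balanced (map fst v)"
proof -
  obtain \<phi> where \<phi>: "\<phi> \<in> auto F2" "sublist v (cyclic_reduction (\<phi> x1))"
    using assms unfolding primitivity_blocking_def by blast
  obtain x y c n where xy: "fst x \<noteq> fst y" and c: "christoffel c"
    and eq: "cyclic_reduction (\<phi> x1) = rotate n (map (case_gen x y) c)"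
    using cyclic_reduction_auto[OF \<phi>(1)] by metis
  have "sublist v (map (case_gen x y) (c @ c))"
    using \<phi>(2) sublist_rotate[of n "map (case_gen x y) c"] sublist_order.order_trans
    unfolding eq map_append by blast
  then obtain u where u: "v = map (case_gen x y) u" "sublist u (c @ c)"
    using sublist_map_rightE by blast
  show "\<forall>z\<in>set v. inv_letter z \<notin> set v"
    using xy by (auto simp: u(1) split: gen.splits)
  have "balanced u" using christoffel_balanced[OF c] u(2) by (rule balanced_sublist)
  moreover have "map fst v = u \<or> map fst v = swap_gens u"
  proof (cases "fst x")
    case X1
    with xy have "fst y = X2" by (cases "fst y") auto
    with X1 have "map fst (map (case_gen x y) u) = u" by (induction u) (auto split: gen.splits)
    then show ?thesis unfolding u(1) ..
  next
    case X2
    with xy have "fst y = X1" by (cases "fst y") auto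
    with X2 have "map fst (map (case_gen x y) u) = swap_gens u"
      by (induction u) (auto split: gen.splits)
    then show ?thesis unfolding u(1) ..
  qed
  ultimately show "balanced (map fst v)" using balanced_swap_gens by auto
qed

section \<open>Balanced words are factors of Christoffel words\<close>

lemma length_expand: "length (expand d) = length d + count_list d X2"
  by (induction d) (auto split: gen.splits)

lemma count_expand_X2: "count_list (expand d) X2 = count_list d X2"
  by (induction d) (auto split: gen.splits)

lemma expand_eq_Nil [simp]: "expand d = [] \<longleftrightarrow> d = []"
  by (cases d) (auto split: gen.splits)

lemma hd_expand: "d \<noteq> [] \<Longrightarrow> hd (expand d) = X1"
  by (cases d) (auto split: gen.splits)

lemma last_expand: "d \<noteq> [] \<Longrightarrow> last (expand d) = last d"
  by (induction d rule: rev_induct) (auto split: gen.splits)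

text \<open>Every \<open>X2\<close> has an \<open>X1\<close> directly in front of it, so the word
  splits into blocks \<open>X1\<close> and \<open>X1 X2\<close>.\<close>

lemma exists_expand:
  assumes "\<not> sublist [X2, X2] w" "w = [] \<or> hd w = X1" shows "\<exists>d. w = expand d"
  using assms
proof (induction w rule: length_induct)
  case (1 w)
  show ?case
  proof (cases w)
    case Nil
    then show ?thesis by (intro exI[of _ "[]"]) simp
  next
    case (Cons g v)
    then have w: "w = X1 # v" using 1(3) by simp
    show ?thesis
    proof (cases "v = [] \<or> hd v = X1")
      case True
      moreover have "\<not> sublist [X2, X2] v" using 1(2) by (simp add: w sublist_Cons_right)
      ultimately obtain d where "v = expand d" using 1(1) w by auto
      then show ?thesis by (intro exI[of _ "X1 # d"]) (simp add: w)
    next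
      case False
      then obtain u where v: "v = X2 # u" by (cases v; cases "hd v") auto
      then have "\<not> sublist [X2, X2] u" "u = [] \<or> hd u = X1"
        using 1(2) by (cases u; cases "hd u"; simp add: w sublist_Cons_right)+
      then obtain d where "u = expand d" using 1(1)[rule_format, of u] w v by auto
      then show ?thesis by (intro exI[of _ "X2 # d"]) (simp add: w v)
    qed
  qed
qed

text \<open>An \<open>X2\<close> at an end of \<open>q\<close> is removed together with the letter
  at the same end of \<open>p\<close>. As \<open>p\<close> loses at most one \<open>X2\<close>, the
  excess does not shrink.\<close>

lemma unbalanced_trim:
  assumes "sublist p w" "sublist q w" "length p = length q"
    "count_list p X2 \<ge> count_list q X2 + 2"
  shows "\<exists>p q. sublist p w \<and> sublist q w \<and> length p = length q \<and>
    count_list p X2 \<ge> count_list q X2 + 2 \<and> q \<noteq> [] \<and> hd q = X1 \<and> last q = X1"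
  using assms
proof (induction q arbitrary: p rule: length_induct)
  case (1 q)
  have "p \<noteq> []" "q \<noteq> []" using 1(4,5) by auto
  have tl: "sublist (tl u) w" "sublist (butlast u) w" if "sublist u w" for u
    using that by (meson sublist_butlast sublist_tl sublist_order.order_trans)+
  show ?case
  proof (cases "hd q = X1")
    case False
    then obtain q' where q: "q = X2 # q'" using \<open>q \<noteq> []\<close> by (cases q; cases "hd q") auto
    obtain a p' where p: "p = a # p'" using \<open>p \<noteq> []\<close> by (cases p) auto
    show ?thesis
      using 1(1)[rule_format, of q' p'] 1(2-5) tl(1)[of p] tl(1)[of q] p q
      by (auto split: if_splits)
  next
    case hd: True
    show ?thesis
    proof (cases "last q = X1")
      case False
      then obtain q' where q: "q = q' @ [X2]"
        using \<open>q \<noteq> []\<close> by (cases q rule: rev_cases; cases "last q") auto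
      obtain a p' where p: "p = p' @ [a]" using \<open>p \<noteq> []\<close> by (cases p rule: rev_cases) auto
      show ?thesis
        using 1(1)[rule_format, of q' p'] 1(2-5) tl(2)[of p] tl(2)[of q] p q
        by (auto split: if_splits)
    next
      case True
      with hd 1 \<open>q \<noteq> []\<close> show ?thesis by blast
    qed
  qed
qed

lemma count_list_drop_ge: "count_list w g \<le> count_list (drop k w) g + k"
  by (induction w arbitrary: k) (auto simp: drop_Cons split: nat.splits intro: le_SucI)

text \<open>
  Factors of \<open>d\<close> violating balance expand to factors of \<open>w\<close>. They are brought to equal
  length by appending \<open>X1\<close> to the one with fewer letters \<open>X2\<close> and shortening the
  other from the left, where the first letter lost is an \<open>X1\<close>.
\<close>

lemma desubstitute:
  assumes bal: "balanced w" and no: "\<not> sublist [X2, X2] w" and w: "w \<noteq> []" "w \<noteq> [X2]"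
  shows "\<exists>d s t. balanced d \<and> length d < length w \<and> expand d @ [X1] = s @ w @ t \<and> length t \<le> 1"
proof -
  define s where "s = (if hd w = X1 then [] else [X1])"
  have "\<not> sublist [X2, X2] (s @ w)" "hd (s @ w) = X1"
    using no w(1) by (auto simp: s_def sublist_Cons_right)
  then obtain e where e: "s @ w = expand e" using exists_expand by blast
  \<comment> \<open>A final \<open>X1\<close> of \<open>w\<close> may be the first half of a cut
    block \<open>X1 X2\<close>, so it is not desubstituted. The \<open>X1\<close> appended to
    \<open>expand d\<close> stands for the letter with which any following block begins.\<close>
  define d where "d = (if last w = X1 then butlast e else e)"
  define t where "t = (if last w = X1 then [] else [X1])"
  have "e \<noteq> []" using e w(1) by auto
  have last_e: "last e = last w" using last_expand[OF \<open>e \<noteq> []\<close>] e w(1) by (metis last_appendR)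
  have eq: "expand d @ [X1] = s @ w @ t"
  proof (cases "last w = X1")
    case True
    then have "e = butlast e @ [X1]" using \<open>e \<noteq> []\<close> last_e by (metis append_butlast_last_id)
    then have "expand e = expand (butlast e) @ [X1]"
      by (metis expand_simps(1,2) expand_simps(3) gen.case(1) append_Nil2)
    then show ?thesis using True e by (simp add: d_def t_def)
  qed (use e in \<open>simp add: d_def t_def\<close>)
  have s_count: "count_list d X2 = count_list w X2"
    using arg_cong[OF eq, of "\<lambda>u. count_list u X2"]
    by (auto simp: count_expand_X2 s_def t_def split: if_splits)
  \<comment> \<open>Among nonempty words only \<open>[X2]\<close> would fail here: it is completed
    to \<open>X1 X2\<close> and desubstituted to itself.\<close>
  have "length d < length w"
  proof -
    have len: "length d + count_list w X2 + 1 = length s + length w + length t"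
      using arg_cong[OF eq, of length] by (simp add: length_expand s_count)
    show ?thesis
    proof (cases "hd w = X1")
      case True
      then show ?thesis
      proof (cases "last w = X1")
        case False
        then have "last w = X2" by (cases "last w") auto
        then have "count_list w X2 > 0" using w(1) last_in_set[of w] count_list_0_iff[of w X2] by auto
        then show ?thesis using len True by (auto simp: s_def t_def split: if_splits)
      qed (use len in \<open>auto simp: s_def t_def\<close>)
    next
      case False
      then obtain v where v: "w = X2 # v" using w(1) by (cases w; cases "hd w") auto
      then show ?thesis
      proof (cases "last w = X1")
        case False
        with v w(2) obtain u where "v = u @ [X2]"
          by (cases v rule: rev_cases; cases "last v") auto
        then show ?thesis using len v by (auto simp: s_def t_def)
      qed (use len v in \<open>auto simp: s_def t_def\<close>)
    qed
  qed
  moreover have "balanced d"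
  proof (rule ccontr)
    assume "\<not> balanced d"
    then obtain p q where "sublist p d" "sublist q d" "length p = length q"
      "count_list q X1 \<ge> count_list p X1 + 2"
      unfolding balanced_def by (metis add_2_eq_Suc' not_less_eq_eq)
    moreover from this have "count_list p X2 \<ge> count_list q X2 + 2"
      using count_gens[of p] count_gens[of q] by linarith
    ultimately obtain p q where pq: "sublist p d" "sublist q d" "length p = length q"
      "count_list p X2 \<ge> count_list q X2 + 2" "q \<noteq> []" "hd q = X1" "last q = X1"
      using unbalanced_trim by metis
    \<comment> \<open>The first \<open>X1\<close> of \<open>expand p\<close> is given up because it
      may be the letter \<open>s\<close>, which lies outside \<open>w\<close>.\<close>
    have "sublist (tl (expand p)) w"
    proof -
      obtain a b where d: "d = a @ p @ b" using pq(1) by (auto simp: sublist_def)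
      have "p \<noteq> []" using pq(3,5) by auto
      then obtain r where r: "expand p = X1 # r"
        using hd_expand[of p] by (cases "expand p") auto
      have "\<exists>b'. s @ w = expand a @ X1 # r @ b'"
      proof (cases "t = []")
        case True
        then show ?thesis using eq by (intro exI[of _ "expand b @ [X1]"]) (simp add: d r)
      next
        case False
        then have "t = [X1]" by (simp add: t_def split: if_splits)
        then show ?thesis using eq by (intro exI[of _ "expand b"]) (simp add: d r)
      qed
      then obtain b' where b': "s @ w = expand a @ X1 # r @ b'" by blast
      have "s = [] \<or> s = [X1]" by (simp add: s_def)
      then have "\<exists>a'. w = a' @ r @ b'"
      proof (elim disjE)
        assume "s = []"
        then show ?thesis using b' by (intro exI[of _ "expand a @ [X1]"]) simp
      next
        assume "s = [X1]"
        then show ?thesis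
          using b' by (cases "expand a") (auto intro: exI[of _ "[]"] exI[of _ "_ @ [X1]"])
      qed
      then show ?thesis unfolding r by (auto simp: sublist_def)
    qed
    \<comment> \<open>Since \<open>q\<close> begins with \<open>X1\<close>, its expansion cannot
      start at an added letter \<open>s\<close>: then \<open>w\<close> would itself begin with
      \<open>X1\<close>. Since \<open>q\<close> ends with \<open>X1\<close>, the \<open>X1\<close>
      behind its expansion lies in \<open>w\<close> even at the end of \<open>d\<close>.\<close>
    moreover have "sublist (expand q @ [X1]) w"
    proof -
      obtain a b where d: "d = a @ q @ b" using pq(2) by (auto simp: sublist_def)
      have "\<exists>b'. s @ w = expand a @ expand q @ X1 # b'"
      proof (cases "b = []")
        case True
        then have "last d = X1" using pq(5,7) d by simp
        then have "t = []" using last_e by (auto simp: d_def t_def split: if_splits)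
        then show ?thesis using eq True by (intro exI[of _ "[]"]) (simp add: d)
      next
        case False
        then obtain y where y: "expand b = X1 # y" using hd_expand[of b] by (cases "expand b") auto
        have "t = [] \<or> t = [X1]" by (simp add: t_def)
        then show ?thesis
        proof (elim disjE)
          assume "t = []"
          then show ?thesis using eq y by (intro exI[of _ "y @ [X1]"]) (simp add: d)
        next
          assume "t = [X1]"
          then show ?thesis using eq y by (intro exI[of _ y]) (simp add: d)
        qed
      qed
      then obtain b' where b': "s @ w = expand a @ (expand q @ [X1]) @ b'" by auto
      show ?thesis
      proof (cases "s = []")
        case True
        then show ?thesis using b' by (auto simp: sublist_def)
      next
        case False
        then have s: "s = [X1]" "hd w \<noteq> X1" by (auto simp: s_def split: if_splits)
        obtain q' where q: "q = X1 # q'" using pq(5,6) by (cases q) auto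
        have "a \<noteq> []"
        proof
          assume "a = []"
          then have "w = expand q' @ X1 # b'" using b' s q by simp
          then show False using s(2) hd_expand[of q'] by (cases "q' = []") auto
        qed
        then obtain a' where "expand a = X1 # a'" using hd_expand[of a] by (cases "expand a") auto
        then have "w = a' @ (expand q @ [X1]) @ b'" using b' s by simp
        then show ?thesis unfolding sublist_def by blast
      qed
    qed
    \<comment> \<open>The lengths before shortening are
      \<open>length p + count_list p X2 - 1\<close> and
      \<open>length q + count_list q X2 + 1\<close>, which differ by \<open>k\<close>. Even if all
      \<open>k\<close> dropped letters are \<open>X2\<close>, an excess of 2 remains.\<close>
    moreover define k where "k = count_list p X2 - count_list q X2 - 2"
    ultimately have "sublist (drop k (tl (expand p))) w" "sublist (expand q @ [X1]) w"
      by (meson sublist_drop sublist_order.order_trans)+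
    moreover have "length (drop k (tl (expand p))) = length (expand q @ [X1])"
      using pq(3,4) by (simp add: length_expand k_def)
    moreover have "count_list (drop k (tl (expand p))) X2 \<ge> count_list q X2 + 2"
    proof -
      have "count_list (tl (expand p)) X2 = count_list p X2"
        using hd_expand[of p] count_expand_X2[of p] by (cases "expand p"; cases p) auto
      then show ?thesis
        using count_list_drop_ge[of "tl (expand p)" X2 k] pq(4) by (simp add: k_def)
    qed
    ultimately show False
      using bal count_gens[of "drop k (tl (expand p))"] count_gens[of "expand q @ [X1]"]
        count_expand_X2[of q]
      unfolding balanced_def by fastforce
  qed
  ultimately show ?thesis using eq by (intro exI[of _ d] exI[of _ s] exI[of _ t]) (simp add: t_def)
qed

text \<open>The continuation \<open>z\<close> makes the induction work: desubstitution recovers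
  \<open>w\<close> only with a following \<open>X1\<close>, and the expansion of \<open>z\<close>
  supplies that letter.\<close>

definition extendable :: "gen list \<Rightarrow> bool" where
  "extendable w \<longleftrightarrow> (\<forall>k. \<exists>c z. christoffel c \<and> k \<le> length z \<and> sublist (w @ z) c)"

lemma christoffel_power: "christoffel (replicate k X1 @ [X2])"
proof (induction k)
  case 0
  then show ?case using christoffel.swap[OF christoffel.single] by simp
next
  case (Suc k)
  have "expand (replicate k X1) = replicate k X1"
    by (induction k) auto
  then show ?case using christoffel.expand[OF Suc.IH] by (simp add: replicate_app_Cons_same)
qed

lemma extendable_Nil: "extendable []"
  unfolding extendable_def
proof
  fix k
  show "\<exists>c z. christoffel c \<and> k \<le> length z \<and> sublist ([] @ z) c"
    using christoffel_power[of k]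
    by (intro exI[of _ "replicate k X1 @ [X2]"] exI[of _ "replicate k X1 @ [X2]"]) simp
qed

lemma extendable_X2: "extendable [X2]"
  unfolding extendable_def
proof
  fix k
  have "swap_gens (replicate (Suc k) X1 @ [X2]) = [X2] @ replicate k X2 @ [X1]"
    by (simp add: swap_gens_def)
  then show "\<exists>c z. christoffel c \<and> k \<le> length z \<and> sublist ([X2] @ z) c"
    using christoffel.swap[OF christoffel_power[of "Suc k"]]
    by (intro exI[of _ "[X2] @ replicate k X2 @ [X1]"] exI[of _ "replicate k X2 @ [X1]"]) simp
qed

lemma extendable_swap_gens: assumes "extendable w" shows "extendable (swap_gens w)"
  unfolding extendable_def
proof
  fix k
  obtain c z where "christoffel c" "k \<le> length z" "sublist (w @ z) c"
    using assms unfolding extendable_def by blast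
  then have "christoffel (swap_gens c)" "k \<le> length (swap_gens z)"
    "sublist (swap_gens w @ swap_gens z) (swap_gens c)"
    using map_mono_sublist[of "w @ z" c "case_gen X2 X1"]
    by (auto simp: swap_gens_def christoffel.swap[unfolded swap_gens_def])
  then show "\<exists>c z. christoffel c \<and> k \<le> length z \<and> sublist (swap_gens w @ z) c" by blast
qed

lemma extendable_expand:
  assumes "extendable d" "expand d @ [X1] = s @ w @ t" "length t \<le> 1"
  shows "extendable w"
  unfolding extendable_def
proof
  fix k
  \<comment> \<open>One letter more than \<open>k\<close> is requested because the first letter of
    \<open>expand z\<close> serves as the \<open>X1\<close> behind \<open>expand d\<close>.\<close>
  obtain c z where cz: "christoffel c" "Suc k \<le> length z" "sublist (d @ z) c"
    using assms unfolding extendable_def by blast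
  then have "z \<noteq> []" by auto
  then obtain y where y: "expand z = X1 # y" using hd_expand[of z] by (cases "expand z") auto
  obtain a b where "c = a @ (d @ z) @ b" using cz(3) by (auto simp: sublist_def)
  then have "expand c = (expand a @ s) @ (w @ t @ y) @ expand b"
    using assms(2) y by simp
  then have "sublist (w @ t @ y) (expand c)" unfolding sublist_def by blast
  moreover have "k \<le> length (t @ y)"
    using cz(2) length_expand[of z] y by simp
  ultimately show "\<exists>c z. christoffel c \<and> k \<le> length z \<and> sublist (w @ z) c"
    using christoffel.expand[OF cz(1)] by blast
qed

text \<open>A balanced word cannot contain both \<open>X1 X1\<close> and \<open>X2 X2\<close>, so
  desubstitution applies to the word or to its swap. The claim \<open>main\<close> ranges over all
  words of at most the same length in order to cover both.\<close>

lemma balanced_extendable: "balanced w \<Longrightarrow> extendable w"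
proof (induction w rule: length_induct)
  case (1 w)
  have main: "extendable v" if v: "balanced v" "length v \<le> length w" "\<not> sublist [X2, X2] v" for v
  proof (cases "v = [] \<or> v = [X2]")
    case True
    then show ?thesis using extendable_Nil extendable_X2 by auto
  next
    case False
    then obtain d s t where "balanced d" "length d < length v"
      and eq: "expand d @ [X1] = s @ v @ t" "length t \<le> 1"
      using desubstitute[OF v(1) v(3)] by blast
    then have "extendable d" using 1(1) v(2) by simp
    then show ?thesis using eq by (rule extendable_expand)
  qed
  show ?case
  proof (cases "sublist [X2, X2] w")
    case False
    then show ?thesis using main[OF 1(2)] by simp
  next
    case True
    have "\<not> sublist [X1, X1] w"
    proof
      assume "sublist [X1, X1] w"
      with True 1(2) show False unfolding balanced_def by fastforce
    qed
    then have "\<not> sublist [X2, X2] (swap_gens w)"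
      using map_mono_sublist[of "[X2, X2]" "swap_gens w" "case_gen X2 X1"]
      by (auto simp flip: swap_gens_def)
    then have "extendable (swap_gens w)"
      using main[of "swap_gens w"] balanced_swap_gens[OF 1(2)] by simp
    then show ?thesis using extendable_swap_gens by fastforce
  qed
qed

lemma not_primitivity_blocking_if:
  assumes sign: "\<forall>x\<in>set v. inv_letter x \<notin> set v" and bal: "balanced (map fst v)"
  shows "\<not> primitivity_blocking v"
proof -
  define x where "x = (X1, (X1, True) \<in> set v)"
  define y where "y = (X2, (X2, True) \<in> set v)"
  have "case_gen x y (fst z) = z" if "z \<in> set v" for z
  proof -
    obtain g b where z: "z = (g, b)" by (cases z)
    then have "(g, True) \<in> set v \<longleftrightarrow> b"
      using sign that by (cases b) (auto simp: inv_letter_def dest: bspec)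
    then show ?thesis by (cases g) (auto simp: z x_def y_def)
  qed
  then have v: "map (case_gen x y) (map fst v) = v" by (simp add: map_idI)
  obtain c z where c: "christoffel c" "sublist (map fst v @ z) c"
    using balanced_extendable[OF bal] unfolding extendable_def by blast
  obtain Y where Y: "symmetric Y" "bijective Y" "Y (X1, True) = pos_word c"
    using christoffel_bijective[OF c(1)] by blast
  have xy: "fst x \<noteq> fst y" by (simp add: x_def y_def)
  define Z where "Z l = subst (\<lambda>z. [signed_gens x y z]) (Y l)" for l
  have Z: "symmetric Z" "bijective Z"
    unfolding Z_def
    by (intro symmetric_subst bijective_subst signed_gens_bijective xy Y)+
  let ?w = "map (case_gen x y) c"
  have Z1: "Z (X1, True) = ?w" by (simp only: Z_def Y(3) subst_signed_gens)
  have sign_w: "\<forall>z\<in>set ?w. inv_letter z \<notin> set ?w"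
    using xy by (auto split: gen.splits)
  let ?\<phi> = "\<lambda>w\<in>carrier F2. reduce (subst Z w)"
  have "x1 \<in> carrier F2" by (simp add: F2_def x1_def reduced_Cons)
  then have "?\<phi> x1 = ?w"
    using sign_consistent_reduced[OF sign_w] by (simp add: x1_def Z1 reduce_id)
  then have "cyclic_reduction (?\<phi> x1) = ?w"
    using cyclic_reduction_sign_consistent[OF sign_w] by simp
  moreover have "sublist v ?w"
    using map_mono_sublist[OF c(2), of "case_gen x y"] unfolding map_append v
    by (meson sublist_append_rightI sublist_order.order_trans sublist_append_leftI)
  ultimately show ?thesis
    using bijective_auto[OF Z] unfolding primitivity_blocking_def by metis
qed

theorem primitivity_blocking_iff:
  "primitivity_blocking v \<longleftrightarrow>
    \<not> ((\<forall>x\<in>set v. inv_letter x \<notin> set v) \<and> balanced (map fst v))"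
  using not_primitivity_blocking_if not_primitivity_blocking_imp by blast

section \<open>The Turing machine\<close>

text \<open>
  Both tapes carry the input. To test all windows of length \<open>k\<close>, the heads move to the right at
  distance \<open>k\<close>, and the finite control only compares the current number of letters \<open>X1\<close> in
  the window with the previous ones: \<open>Flat\<close> if they all agree, \<open>Low\<close> or \<open>High\<close> if two
  consecutive numbers have occurred. Rewinding until the first head is left of the input preserves
  the distance of the heads, which \<open>Advance\<close> then increases by 1. The
  final states are \<open>Blocked\<close> and, for words that are not primitivity-blocking, \<open>Free\<close>.
\<close>

datatype control = Copy "letter set" | Rewind | Advance | Start | Flat | Low | High | Free | Blocked

instance control :: finite
proof
  have "(UNIV :: control set) \<subseteq>
      range Copy \<union> {Rewind, Advance, Start, Flat, Low, High, Free, Blocked}"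
  proof
    fix q :: control
    show "q \<in> range Copy \<union> {Rewind, Advance, Start, Flat, Low, High, Free, Blocked}"
      by (cases q) simp_all
  qed
  then show "finite (UNIV :: control set)" by (rule finite_subset) simp
qed

text \<open>The first head reads the letter that leaves the window and the second the one that
  enters. The control arguments are the successors for an unchanged, increased and decreased count
  of \<open>X1\<close>.\<close>

fun slide :: "control \<Rightarrow> control \<Rightarrow> control \<Rightarrow> letter symbol \<Rightarrow> letter symbol \<Rightarrow>
    control \<times> move \<times> move" where
  "slide same up down (Input x) (Input y) =
     (if fst x = fst y then same else if fst y = X1 then up else down, Right, Right)"
| "slide _ _ _ _ _ = (Rewind, Left, Left)"

text \<open>\<open>Copy S\<close> remembers the letters read so far, so the sign test happens during
  copying. In \<open>Start\<close> the second head sees a blank exactly when the window is at least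
  as long as the input, and all shorter lengths have passed.\<close>

fun delta :: "control \<Rightarrow> letter symbol \<Rightarrow> letter symbol \<Rightarrow> control \<times> move \<times> move" where
  "delta (Copy S) a b =
     (case a of
        Input x \<Rightarrow> (if inv_letter x \<in> S then Blocked else Copy (insert x S), Right, Right)
      | _ \<Rightarrow> (Rewind, Left, Left))"
| "delta Rewind a b = (if a = Blank then (Advance, Right, Right) else (Rewind, Left, Left))"
| "delta Advance a b = (Start, Stay, Right)"
| "delta Start a b = (if b = Blank then Free else Flat, Stay, Stay)"
| "delta Flat a b = slide Flat High Low a b"
| "delta Low a b = slide Low High Blocked a b"
| "delta High a b = slide High Blocked Low a b"
| "delta Free a b = (Free, Stay, Stay)"
| "delta Blocked a b = (Blocked, Stay, Stay)"

fun written :: "control \<Rightarrow> letter symbol \<Rightarrow> letter symbol \<Rightarrow> letter symbol" where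
  "written (Copy S) a b = a"
| "written _ a b = b"

definition machine :: "letter tm" where
  "machine =
     \<lparr>num_tapes = 2, states = range (to_nat :: control \<Rightarrow> nat),
      symbols = insert Blank (range Input),
      trans_fun = (\<lambda>q ss. case delta (from_nat q) (ss ! 0) (ss ! 1) of (q', m1, m2) \<Rightarrow>
        (to_nat q', [(ss ! 0, m1), (written (from_nat q) (ss ! 0) (ss ! 1), m2)])),
      start_state = to_nat (Copy {}), accept_state = to_nat Blocked, reject_state = to_nat Free\<rparr>"

lemma written_cases: "written q a b \<in> {a, b}"
  by (cases q) auto

lemma wf_machine: "wf_tm machine"
proof -
  have "case trans_fun machine q ss of (q', acts) \<Rightarrow>
      q' \<in> states machine \<and> length acts = num_tapes machine \<and> fst ` set acts \<subseteq> symbols machine"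
    if "length ss = num_tapes machine" "set ss \<subseteq> symbols machine" for q ss
  proof -
    have "ss ! 0 \<in> symbols machine" "ss ! 1 \<in> symbols machine"
      using that nth_mem[of 0 ss] nth_mem[of 1 ss] by (auto simp: machine_def simp del: nth_mem)
    moreover from this have "written (from_nat q) (ss ! 0) (ss ! 1) \<in> symbols machine"
      using written_cases[of "from_nat q" "ss ! 0" "ss ! 1"] by auto
    ultimately show ?thesis
      by (simp add: machine_def split: prod.splits)
  qed
  then show ?thesis
    unfolding wf_tm_def by (simp add: machine_def subset_insertI)
qed

text \<open>No transition changes the first tape, so only the contents of the second are a
  parameter.\<close>

definition config :: "letter list \<Rightarrow> control \<Rightarrow> (int \<Rightarrow> letter symbol) \<Rightarrow> int \<Rightarrow> int \<Rightarrow> letter config" where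
  "config w q t i j = (to_nat q, [(initial_tape w, i), (t, j)])"

abbreviation scan :: "letter list \<Rightarrow> control \<Rightarrow> int \<Rightarrow> int \<Rightarrow> letter config" where
  "scan w q i j \<equiv> config w q (initial_tape w) i j"

lemma step_config:
  assumes "q \<notin> {Free, Blocked}" "delta q (initial_tape w i) (t j) = (q', m1, m2)"
  shows "step machine (config w q t i j) =
    config w q' (t(j := written q (initial_tape w i) (t j))) (i + offset m1) (j + offset m2)"
proof -
  have "to_nat q \<notin> {accept_state machine, reject_state machine}"
    using assms(1) by (simp add: machine_def)
  moreover have "trans_fun machine (to_nat q) [initial_tape w i, t j] =
      (to_nat q', [(initial_tape w i, m1), (written q (initial_tape w i) (t j), m2)])"
    by (simp add: machine_def assms(2))
  ultimately show ?thesis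
    unfolding step_def config_def by simp
qed

lemma step_scan:
  assumes "q \<notin> {Free, Blocked} \<union> range Copy"
    "delta q (initial_tape w i) (initial_tape w j) = (q', m1, m2)"
  shows "step machine (scan w q i j) = scan w q' (i + offset m1) (j + offset m2)"
proof -
  have written: "written q a b = b" for a b using assms(1) by (cases q) simp_all
  have "q \<notin> {Free, Blocked}" using assms(1) by simp
  from step_config[where t = "initial_tape w", OF this assms(2)] show ?thesis
    by (simp only: written fun_upd_triv)
qed

section \<open>Runs within a bounded number of steps\<close>

definition reaches :: "nat \<Rightarrow> letter config \<Rightarrow> letter config \<Rightarrow> bool" where
  "reaches k c d \<longleftrightarrow> (\<exists>t\<le>k. (step machine ^^ t) c = d)"

definition halts :: "nat \<Rightarrow> letter config \<Rightarrow> control \<Rightarrow> bool" where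
  "halts k c q \<longleftrightarrow> (\<exists>t\<le>k. fst ((step machine ^^ t) c) = to_nat q)"

lemma reaches_refl: "reaches k c c"
  unfolding reaches_def by (intro exI[of _ 0]) simp

lemma reaches_trans: assumes "reaches a c d" "reaches b d e" shows "reaches (a + b) c e"
proof -
  obtain s t where "s \<le> a" "(step machine ^^ s) c = d" "t \<le> b" "(step machine ^^ t) d = e"
    using assms unfolding reaches_def by blast
  then have "t + s \<le> a + b" "(step machine ^^ (t + s)) c = e" by (simp_all add: funpow_add)
  then show ?thesis unfolding reaches_def by blast
qed

lemma reaches_halts: assumes "reaches a c d" "halts b d q" shows "halts (a + b) c q"
proof -
  obtain t where "t \<le> b" "fst ((step machine ^^ t) d) = to_nat q"
    using assms(2) unfolding halts_def by blast
  then have "reaches b d ((step machine ^^ t) d)" unfolding reaches_def by blast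
  then have "reaches (a + b) c ((step machine ^^ t) d)" by (rule reaches_trans[OF assms(1)])
  then show ?thesis
    using \<open>fst ((step machine ^^ t) d) = to_nat q\<close> unfolding halts_def reaches_def by metis
qed

lemma reaches_step: "step machine c = d \<Longrightarrow> reaches (Suc 0) c d"
  unfolding reaches_def by (intro exI[of _ 1]) simp

lemma halts_mono: "halts a c q \<Longrightarrow> a \<le> b \<Longrightarrow> halts b c q"
  unfolding halts_def by (meson order_trans)

lemma reaches_mono: "reaches a c d \<Longrightarrow> a \<le> b \<Longrightarrow> reaches b c d"
  unfolding reaches_def by (metis order_trans)

lemma halts_config: "halts k (config w q t i j) q"
  unfolding halts_def by (intro exI[of _ 0]) (simp add: config_def)

lemma initial_tape_nth: "i < length w \<Longrightarrow> initial_tape w (int i) = Input (w ! i)"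
  by (simp add: initial_tape_def)

lemma initial_tape_Blank: "i < 0 \<or> int (length w) \<le> i \<Longrightarrow> initial_tape w i = Blank"
  by (auto simp: initial_tape_def)

lemma initial_tape_take_Suc:
  "i < length w \<Longrightarrow> (initial_tape (take i w))(int i := Input (w ! i)) = initial_tape (take (Suc i) w)"
  by (auto simp: initial_tape_def fun_eq_iff nth_append take_Suc_conv_app_nth)

lemma copy_phase:
  assumes "i \<le> length w" "\<And>j. j < i \<Longrightarrow> inv_letter (w ! j) \<notin> set (take j w)"
  shows "reaches i (config w (Copy {}) (\<lambda>_. Blank) 0 0)
    (config w (Copy (set (take i w))) (initial_tape (take i w)) (int i) (int i))"
  using assms
proof (induction i)
  case 0
  have "initial_tape [] = (\<lambda>_. Blank)" by (simp add: initial_tape_def fun_eq_iff)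
  then have "config w (Copy (set (take 0 w))) (initial_tape (take 0 w)) (int 0) (int 0) =
      config w (Copy {}) (\<lambda>_. Blank) 0 0"
    by (simp add: config_def)
  then show ?case by (metis reaches_refl)
next
  case (Suc i)
  then have i: "i < length w" by simp
  let ?t = "initial_tape (take i w)"
  have "reaches (i + Suc 0) (config w (Copy {}) (\<lambda>_. Blank) 0 0)
     (config w (Copy (insert (w ! i) (set (take i w))))
       (?t(int i := Input (w ! i))) (int i + offset Right) (int i + offset Right))"
  proof (rule reaches_trans)
    show "reaches i (config w (Copy {}) (\<lambda>_. Blank) 0 0)
        (config w (Copy (set (take i w))) ?t (int i) (int i))"
      using Suc by simp
    show "reaches (Suc 0) (config w (Copy (set (take i w))) ?t (int i) (int i))
      (config w (Copy (insert (w ! i) (set (take i w))))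
       (?t(int i := Input (w ! i))) (int i + offset Right) (int i + offset Right))"
      using step_config[of "Copy (set (take i w))" w "int i" ?t "int i"] Suc.prems(2)[of i]
      by (intro reaches_step) (simp add: initial_tape_nth i)
  qed
  then show ?case
    unfolding initial_tape_take_Suc[OF i] using i by (simp add: take_Suc_conv_app_nth add.commute)
qed

lemma copy_consistent:
  assumes "\<forall>x\<in>set w. inv_letter x \<notin> set w"
  shows "reaches (length w + 1) (config w (Copy {}) (\<lambda>_. Blank) 0 0)
    (scan w Rewind (int (length w) - 1) (int (length w) - 1))"
proof -
  let ?n = "int (length w)"
  have "reaches (length w) (config w (Copy {}) (\<lambda>_. Blank) 0 0) (scan w (Copy (set w)) ?n ?n)"
  proof -
    have "inv_letter (w ! j) \<notin> set (take j w)" if "j < length w" for j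
      using assms that by (meson in_set_takeD nth_mem)
    then show ?thesis using copy_phase[of "length w" w] by simp
  qed
  moreover have "step machine (scan w (Copy (set w)) ?n ?n) = scan w Rewind (?n - 1) (?n - 1)"
    using step_config[of "Copy (set w)" w ?n "initial_tape w" ?n Rewind Left Left]
    by (simp add: initial_tape_Blank fun_upd_idem)
  ultimately show ?thesis using reaches_trans[OF _ reaches_step] by simp
qed

lemma copy_inconsistent:
  assumes "\<not> (\<forall>x\<in>set w. inv_letter x \<notin> set w)"
  shows "halts (length w) (config w (Copy {}) (\<lambda>_. Blank) 0 0) Blocked"
proof -
  define P where "P i \<longleftrightarrow> i < length w \<and> inv_letter (w ! i) \<in> set (take i w)" for i
  obtain a b where ab: "a < length w" "b < length w" "w ! b = inv_letter (w ! a)"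
    using assms by (metis in_set_conv_nth)
  then have "a \<noteq> b" by auto
  have in_take: "w ! i \<in> set (take j w)" if "i < j" "j < length w" for i j
    using that by (auto simp: in_set_conv_nth)
  have "P a \<or> P b"
    using \<open>a \<noteq> b\<close> ab in_take[of a b] in_take[of b a] by (auto simp: P_def neq_iff)
  then obtain i where "P i" and least: "\<And>j. j < i \<Longrightarrow> \<not> P j"
    by (metis exists_least_iff)
  then have i: "i < length w" "inv_letter (w ! i) \<in> set (take i w)" by (auto simp: P_def)
  have "reaches i (config w (Copy {}) (\<lambda>_. Blank) 0 0)
    (config w (Copy (set (take i w))) (initial_tape (take i w)) (int i) (int i))"
    using least i by (intro copy_phase) (auto simp: P_def)
  moreover have "halts (Suc 0)
      (config w (Copy (set (take i w))) (initial_tape (take i w)) (int i) (int i)) Blocked"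
    using reaches_halts[OF reaches_step[OF step_config] halts_config[of 0]] i
    by (simp add: initial_tape_nth)
  ultimately have "halts (i + Suc 0) (config w (Copy {}) (\<lambda>_. Blank) 0 0) Blocked"
    by (rule reaches_halts)
  then show ?thesis by (rule halts_mono) (use i in simp)
qed

text \<open>After \<open>m\<close> moves the first head is on the blank at -1. Two more steps return
  it to 0 and widen the distance by 1.\<close>

lemma rewind:
  assumes "m \<le> length w"
  shows "reaches (m + 2) (scan w Rewind (int m - 1) (int m - 1 + j)) (scan w Start 0 (j + 1))"
  using assms
proof (induction m)
  case 0
  have "step machine (scan w Rewind (- 1) (j - 1)) = scan w Advance 0 j"
    using step_scan[of Rewind w "- 1" "j - 1" Advance Right Right]
    by (auto simp: initial_tape_Blank)
  moreover have "step machine (scan w Advance 0 j) = scan w Start 0 (j + 1)"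
    using step_scan[of Advance w 0 j Start Stay Right] by auto
  ultimately show ?case
    using reaches_trans[OF reaches_step reaches_step] by (simp add: numeral_2_eq_2)
next
  case (Suc m)
  have "step machine (scan w Rewind (int m) (int m + j)) = scan w Rewind (int m - 1) (int m - 1 + j)"
    using step_scan[of Rewind w "int m" "int m + j" Rewind Left Left] Suc.prems
    by (auto simp: initial_tape_nth algebra_simps)
  then show ?case
    using reaches_trans[OF reaches_step Suc.IH] Suc.prems by simp
qed

section \<open>Windows of a fixed length\<close>

definition window_count :: "letter list \<Rightarrow> nat \<Rightarrow> nat \<Rightarrow> nat" where
  "window_count w k i = count_list (take k (drop i (map fst w))) X1"

definition windows_balanced :: "letter list \<Rightarrow> nat \<Rightarrow> bool" where
  "windows_balanced w k \<longleftrightarrow> (\<forall>i j. i + k \<le> length w \<and> j + k \<le> length w \<longrightarrow>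
     window_count w k i \<le> Suc (window_count w k j))"

text \<open>There is only one factor of length 0 and one of full length, so only the lengths in
  between can violate balance.\<close>

lemma balanced_iff_windows:
  "balanced (map fst w) \<longleftrightarrow> (\<forall>k. 1 \<le> k \<and> k < length w \<longrightarrow> windows_balanced w k)"
proof
  assume bal: "balanced (map fst w)"
  have "sublist (take k (drop i (map fst w))) (map fst w)" for k i
    by (meson sublist_drop sublist_order.order_trans sublist_take)
  then show "\<forall>k. 1 \<le> k \<and> k < length w \<longrightarrow> windows_balanced w k"
    using bal by (auto simp: balanced_def windows_balanced_def window_count_def)
next
  assume win: "\<forall>k. 1 \<le> k \<and> k < length w \<longrightarrow> windows_balanced w k"
  show "balanced (map fst w)"
    unfolding balanced_def
  proof (intro allI impI, elim conjE)
    fix u v assume uv: "sublist u (map fst w)" "sublist v (map fst w)" and len: "length u = length v"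
    have window: "\<exists>i. i + length u \<le> length w \<and> take (length u) (drop i (map fst w)) = u"
      if "sublist u (map fst w)" for u
    proof -
      obtain a b where ab: "map fst w = a @ u @ b" using \<open>sublist u _\<close> by (auto simp: sublist_def)
      have "length (map fst w) = length (a @ u @ b)" by (simp only: ab)
      then have "length w = length a + length u + length b" by simp
      then show ?thesis using ab by (intro exI[of _ "length a"]) simp
    qed
    obtain i where i: "i + length u \<le> length w" "take (length u) (drop i (map fst w)) = u"
      using window[OF uv(1)] by blast
    obtain j where j: "j + length u \<le> length w" "take (length u) (drop j (map fst w)) = v"
      using window[OF uv(2)] len by auto
    show "count_list u X1 \<le> Suc (count_list v X1)"
    proof (cases "1 \<le> length u \<and> length u < length w")
      case True
      then have "window_count w (length u) i \<le> Suc (window_count w (length u) j)"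
        using win i(1) j(1) unfolding windows_balanced_def by blast
      then show ?thesis unfolding window_count_def i(2) j(2) .
    next
      case False
      then have "length u = 0 \<or> i = 0 \<and> j = 0" using i(1) j(1) by linarith
      then have "u = v" using i(2) j(2) by (elim disjE) auto
      then show ?thesis by simp
    qed
  qed
qed

lemma window_count_Suc:
  assumes "i + k < length w" "1 \<le> k"
  shows "window_count w k (Suc i) + (if fst (w ! i) = X1 then 1 else 0) =
    window_count w k i + (if fst (w ! (i + k)) = X1 then 1 else 0)"
proof -
  obtain m where k: "k = Suc m" using assms(2) by (cases k) auto
  let ?c = "map fst w" let ?u = "take m (drop (Suc i) (map fst w))"
  have "take k (drop i ?c) = fst (w ! i) # ?u"
    using assms(1) by (simp add: k Cons_nth_drop_Suc[symmetric])
  moreover have "take k (drop (Suc i) ?c) = ?u @ [fst (w ! (i + k))]"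
    using assms(1) by (simp add: k take_Suc_conv_app_nth add.commute)
  ultimately show ?thesis by (simp add: window_count_def)
qed

text \<open>\<open>Low\<close> and \<open>High\<close> record that the current count is the smaller
  or larger of two consecutive values that have both occurred. So one further step in the same
  direction is a proof of imbalance.\<close>

fun window_inv :: "(nat \<Rightarrow> nat) \<Rightarrow> control \<Rightarrow> nat \<Rightarrow> bool" where
  "window_inv f Flat i \<longleftrightarrow> (\<forall>j\<le>i. f j \<le> f i \<and> f i \<le> f j)"
| "window_inv f Low i \<longleftrightarrow> (\<forall>j\<le>i. f i \<le> f j \<and> f j \<le> Suc (f i)) \<and> (\<exists>j\<le>i. f i < f j)"
| "window_inv f High i \<longleftrightarrow> (\<forall>j\<le>i. f j \<le> f i \<and> f i \<le> Suc (f j)) \<and> (\<exists>j\<le>i. f j < f i)"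
| "window_inv f Blocked i \<longleftrightarrow> (\<exists>a\<le>i. \<exists>b\<le>i. f a \<ge> f b + 2)"
| "window_inv f _ i \<longleftrightarrow> False"

lemma all_le_SucI:
  "(\<forall>j\<le>i. P j) \<Longrightarrow> (\<And>j. P j \<Longrightarrow> Q j) \<Longrightarrow> Q (Suc i) \<Longrightarrow> \<forall>j\<le>Suc i. Q j"
  by (auto simp: le_Suc_eq)

lemma window_inv_same:
  assumes "f (Suc i) = f i" "q \<in> {Flat, Low, High}" "window_inv f q i"
  shows "window_inv f q (Suc i)"
proof -
  consider "q = Flat" | "q = Low" | "q = High" using assms(2) by blast
  then show ?thesis
  proof cases
    case 1
    then have inv: "\<forall>j\<le>i. f j \<le> f i \<and> f i \<le> f j" using assms(3) by simp
    have "\<forall>j\<le>Suc i. f j \<le> f (Suc i) \<and> f (Suc i) \<le> f j"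
      using inv by (rule all_le_SucI) (simp_all add: assms(1))
    then show ?thesis by (simp add: 1)
  next
    case 2
    then have inv: "\<forall>j\<le>i. f i \<le> f j \<and> f j \<le> Suc (f i)" "\<exists>j\<le>i. f i < f j" using assms(3) by simp_all
    have "\<forall>j\<le>Suc i. f (Suc i) \<le> f j \<and> f j \<le> Suc (f (Suc i))"
      using inv(1) by (rule all_le_SucI) (simp_all add: assms(1))
    moreover have "\<exists>j\<le>Suc i. f (Suc i) < f j" using inv(2) unfolding assms(1) by (meson le_SucI)
    ultimately show ?thesis by (simp add: 2)
  next
    case 3
    then have inv: "\<forall>j\<le>i. f j \<le> f i \<and> f i \<le> Suc (f j)" "\<exists>j\<le>i. f j < f i" using assms(3) by simp_all
    have "\<forall>j\<le>Suc i. f j \<le> f (Suc i) \<and> f (Suc i) \<le> Suc (f j)"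
      using inv(1) by (rule all_le_SucI) (simp_all add: assms(1))
    moreover have "\<exists>j\<le>Suc i. f j < f (Suc i)" using inv(2) unfolding assms(1) by (meson le_SucI)
    ultimately show ?thesis by (simp add: 3)
  qed
qed

lemma window_inv_up:
  assumes "f (Suc i) = Suc (f i)"
  shows "window_inv f q i \<Longrightarrow> q = Flat \<or> q = Low \<Longrightarrow> window_inv f High (Suc i)"
    "window_inv f High i \<Longrightarrow> window_inv f Blocked (Suc i)"
proof -
  assume "window_inv f q i" "q = Flat \<or> q = Low"
  then have "\<forall>j\<le>i. f i \<le> f j \<and> f j \<le> Suc (f i)" by (auto intro: le_SucI)
  then have "\<forall>j\<le>Suc i. f j \<le> f (Suc i) \<and> f (Suc i) \<le> Suc (f j)"
    by (rule all_le_SucI) (simp_all add: assms)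
  moreover have "\<exists>j\<le>Suc i. f j < f (Suc i)" by (intro exI[of _ i]) (simp add: assms)
  ultimately show "window_inv f High (Suc i)" by simp
next
  assume "window_inv f High i"
  then obtain j where "j \<le> i" "f j < f i" by auto
  then show "window_inv f Blocked (Suc i)"
    using assms unfolding window_inv.simps by (intro exI[of _ "Suc i"] exI[of _ j] conjI) simp_all
qed

lemma window_inv_down:
  assumes "f i = Suc (f (Suc i))"
  shows "window_inv f q i \<Longrightarrow> q = Flat \<or> q = High \<Longrightarrow> window_inv f Low (Suc i)"
    "window_inv f Low i \<Longrightarrow> window_inv f Blocked (Suc i)"
proof -
  assume "window_inv f q i" "q = Flat \<or> q = High"
  then have "\<forall>j\<le>i. f j \<le> f i \<and> f i \<le> Suc (f j)" by (auto intro: le_SucI)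
  then have "\<forall>j\<le>Suc i. f (Suc i) \<le> f j \<and> f j \<le> Suc (f (Suc i))"
    by (rule all_le_SucI) (simp_all add: assms)
  moreover have "\<exists>j\<le>Suc i. f (Suc i) < f j" by (intro exI[of _ i]) (simp add: assms)
  ultimately show "window_inv f Low (Suc i)" by simp
next
  assume "window_inv f Low i"
  then obtain j where "j \<le> i" "f i < f j" by auto
  then show "window_inv f Blocked (Suc i)"
    using assms unfolding window_inv.simps by (intro exI[of _ j] exI[of _ "Suc i"] conjI) simp_all
qed

text \<open>The count changes by at most one per shift, and the two scanned letters tell
  how.\<close>

lemma window_step:
  assumes q: "q \<in> {Flat, Low, High}" and inv: "window_inv (window_count w k) q i"
    and ik: "i + k < length w" and k: "1 \<le> k"
  shows "\<exists>q'. q' \<in> {Flat, Low, High, Blocked} \<and> window_inv (window_count w k) q' (Suc i) \<and>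
    step machine (scan w q (int i) (int (i + k))) = scan w q' (int (Suc i)) (int (Suc i + k))"
proof -
  define q' where "q' = fst (delta q (initial_tape w (int i)) (initial_tape w (int (i + k))))"
  have tape: "initial_tape w (int i) = Input (w ! i)"
    "initial_tape w (int (i + k)) = Input (w ! (i + k))"
    using ik by (intro initial_tape_nth; simp)+
  have "delta q (initial_tape w (int i)) (initial_tape w (int (i + k))) = (q', Right, Right)"
    using q by (auto simp: q'_def tape simp del: of_nat_add)
  then have "step machine (scan w q (int i) (int (i + k))) = scan w q' (int (Suc i)) (int (Suc i + k))"
    using step_scan[of q w "int i" "int (i + k)" q' Right Right] q by (auto simp: algebra_simps)
  moreover have "q' \<in> {Flat, Low, High, Blocked} \<and> window_inv (window_count w k) q' (Suc i)"
  proof -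
    have count: "window_count w k (Suc i) + (if fst (w ! i) = X1 then 1 else 0) =
        window_count w k i + (if fst (w ! (i + k)) = X1 then 1 else 0)"
      by (rule window_count_Suc[OF ik k])
    have q': "q' = (if fst (w ! i) = fst (w ! (i + k)) then q
        else if fst (w ! (i + k)) = X1 then (if q = High then Blocked else High)
        else (if q = Low then Blocked else Low))"
      using q by (auto simp: q'_def tape simp del: of_nat_add)
    consider "fst (w ! i) = fst (w ! (i + k))"
      | "fst (w ! i) = X2" "fst (w ! (i + k)) = X1" | "fst (w ! i) = X1" "fst (w ! (i + k)) = X2"
      by (cases "fst (w ! i)"; cases "fst (w ! (i + k))") auto
    then show ?thesis
    proof cases
      case 1
      then have "window_count w k (Suc i) = window_count w k i" using count by simp
      from window_inv_same[of "window_count w k", OF this q inv]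
      have "window_inv (window_count w k) q (Suc i)" .
      moreover have "q' = q" using 1 by (simp add: q')
      ultimately show ?thesis using q by blast
    next
      case 2
      then have "window_count w k (Suc i) = Suc (window_count w k i)" using count by simp
      note up = window_inv_up[of "window_count w k", OF this]
      show ?thesis
      proof (cases "q = High")
        case True
        then have "window_inv (window_count w k) Blocked (Suc i)" using inv up(2) by blast
        moreover have "q' = Blocked" using True 2 by (simp add: q')
        ultimately show ?thesis by blast
      next
        case False
        then have "q = Flat \<or> q = Low" using q by blast
        with inv have "window_inv (window_count w k) High (Suc i)" by (rule up(1))
        moreover have "q' = High" using False 2 by (simp add: q')
        ultimately show ?thesis by blast
      qed
    next
      case 3
      then have "window_count w k i = Suc (window_count w k (Suc i))" using count by simp
      note down = window_inv_down[of "window_count w k", OF this]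
      show ?thesis
      proof (cases "q = Low")
        case True
        then have "window_inv (window_count w k) Blocked (Suc i)" using inv down(2) by blast
        moreover have "q' = Blocked" using True 3 by (simp add: q')
        ultimately show ?thesis by blast
      next
        case False
        then have "q = Flat \<or> q = High" using q by blast
        with inv have "window_inv (window_count w k) Low (Suc i)" by (rule down(1))
        moreover have "q' = Low" using False 3 by (simp add: q')
        ultimately show ?thesis by blast
      qed
    qed
  qed
  ultimately show ?thesis by blast
qed

text \<open>There are \<open>length w - (i + k)\<close> shifts left, and one more step in which the
  second head finds the blank behind the input and both heads turn back.\<close>

lemma window_pass:
  assumes "i + k \<le> length w" "1 \<le> k" "q \<in> {Flat, Low, High}" "window_inv (window_count w k) q i"
  shows "if windows_balanced w k
    then reaches (Suc (length w - (i + k))) (scan w q (int i) (int (i + k)))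
      (scan w Rewind (int (length w - k) - 1) (int (length w) - 1))
    else halts (Suc (length w - (i + k))) (scan w q (int i) (int (i + k))) Blocked"
  using assms(1,3,4)
proof (induction "length w - (i + k)" arbitrary: i q)
  case 0
  then have ik: "i + k = length w" by simp
  have "window_count w k a \<le> Suc (window_count w k b)" if "a \<le> i" "b \<le> i" for a b
  proof -
    let ?f = "window_count w k"
    have "(\<forall>j\<le>i. ?f i \<le> ?f j \<and> ?f j \<le> Suc (?f i)) \<or> (\<forall>j\<le>i. ?f j \<le> ?f i \<and> ?f i \<le> Suc (?f j))"
      using 0(3,4) by (auto intro: le_SucI)
    then show ?thesis
    proof (elim disjE)
      assume *: "\<forall>j\<le>i. ?f i \<le> ?f j \<and> ?f j \<le> Suc (?f i)"
      show ?thesis using *[rule_format, OF that(1)] *[rule_format, OF that(2)] by linarith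
    next
      assume *: "\<forall>j\<le>i. ?f j \<le> ?f i \<and> ?f i \<le> Suc (?f j)"
      show ?thesis using *[rule_format, OF that(1)] *[rule_format, OF that(2)] by linarith
    qed
  qed
  then have "windows_balanced w k" using ik by (simp add: windows_balanced_def flip: ik)
  moreover have "delta q (initial_tape w (int i)) (initial_tape w (int (i + k))) = (Rewind, Left, Left)"
    using 0(3) ik initial_tape_Blank[of "int (i + k)" w] by (auto split: symbol.splits)
  then have "step machine (scan w q (int i) (int (i + k))) =
      scan w Rewind (int (length w - k) - 1) (int (length w) - 1)"
    using step_scan[of q w "int i" "int (i + k)" Rewind Left Left] 0(3) by (auto simp: ik[symmetric])
  ultimately show ?case using reaches_mono[OF reaches_step] by simp
next
  case (Suc m)
  then have ik: "i + k < length w" by simp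
  obtain q' where q': "q' \<in> {Flat, Low, High, Blocked}" "window_inv (window_count w k) q' (Suc i)"
    and step: "step machine (scan w q (int i) (int (i + k))) = scan w q' (int (Suc i)) (int (Suc i + k))"
    using window_step[OF Suc.prems(2,3) ik assms(2)] by blast
  have len: "Suc (length w - (i + k)) = Suc 0 + Suc (length w - (Suc i + k))" using ik by simp
  show ?case
  proof (cases "q' = Blocked")
    case True
    then obtain a b where ab: "a \<le> Suc i" "b \<le> Suc i" "window_count w k a \<ge> window_count w k b + 2"
      using q'(2) by auto
    then have "\<not> windows_balanced w k"
      unfolding windows_balanced_def using ik by (intro notI) (force dest: spec[of _ a] spec[of _ b])
    moreover have "halts (Suc 0 + Suc (length w - (Suc i + k))) (scan w q (int i) (int (i + k))) Blocked"
      using reaches_halts[OF reaches_step[OF step] halts_config] True by simp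
    ultimately show ?thesis unfolding len by simp
  next
    case False
    then have "q' \<in> {Flat, Low, High}" using q'(1) by blast
    then have "if windows_balanced w k
      then reaches (Suc (length w - (Suc i + k))) (scan w q' (int (Suc i)) (int (Suc i + k)))
        (scan w Rewind (int (length w - k) - 1) (int (length w) - 1))
      else halts (Suc (length w - (Suc i + k))) (scan w q' (int (Suc i)) (int (Suc i + k))) Blocked"
      using Suc.hyps ik q'(2) by (intro Suc.hyps(1)) auto
    then show ?thesis
      unfolding len using reaches_trans[OF reaches_step[OF step]] reaches_halts[OF reaches_step[OF step]]
      by (simp split: if_splits)
  qed
qed

text \<open>With \<open>n = length w\<close>, length \<open>k\<close> costs 1 step in
  \<open>Start\<close>, at most \<open>n - k + 1\<close> for the pass and \<open>n - k + 2\<close>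
  for rewinding, at most \<open>2 * n + 4\<close> in total. The final 1 is the step to
  \<open>Free\<close>.\<close>

lemma scan_phase:
  assumes "1 \<le> k"
  shows "halts ((length w - k) * (2 * length w + 4) + 1) (scan w Start 0 (int k))
    (if \<forall>l. k \<le> l \<and> l < length w \<longrightarrow> windows_balanced w l then Free else Blocked)"
  using assms
proof (induction "length w - k" arbitrary: k)
  case 0
  then have "step machine (scan w Start 0 (int k)) = scan w Free 0 (int k)"
    using step_scan[of Start w 0 "int k" Free Stay Stay] by (auto simp: initial_tape_Blank)
  then have "halts (Suc 0 + 0) (scan w Start 0 (int k)) Free"
    by (rule reaches_halts[OF reaches_step halts_config])
  moreover have "\<forall>l. k \<le> l \<and> l < length w \<longrightarrow> windows_balanced w l" using 0 by auto
  ultimately show ?case using 0 by (simp only: if_True) simp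
next
  case (Suc m)
  let ?n = "length w"
  have k: "k < ?n" using Suc.hyps(2) by simp
  have "step machine (scan w Start 0 (int k)) = scan w Flat 0 (int k)"
    using step_scan[of Start w 0 "int k" Flat Stay Stay] k by (auto simp: initial_tape_nth)
  note start = reaches_step[OF this]
  have pass: "if windows_balanced w k
    then reaches (Suc (?n - k)) (scan w Flat 0 (int k)) (scan w Rewind (int (?n - k) - 1) (int ?n - 1))
    else halts (Suc (?n - k)) (scan w Flat 0 (int k)) Blocked"
    using k Suc.prems by (intro window_pass[of 0 k w Flat, unfolded add_0 of_nat_0]) simp_all
  have bound: "Suc 0 + (Suc (?n - k) + (?n - k + 2 + ((?n - Suc k) * (2 * ?n + 4) + 1)))
      \<le> (?n - k) * (2 * ?n + 4) + 1"
  proof -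
    have "?n - k = Suc (?n - Suc k)" using k by simp
    then have "(?n - k) * (2 * ?n + 4) = (?n - Suc k) * (2 * ?n + 4) + (2 * ?n + 4)" by simp
    then show ?thesis using k by linarith
  qed
  show ?case
  proof (cases "windows_balanced w k")
    case False
    then have "halts (Suc 0 + Suc (?n - k)) (scan w Start 0 (int k)) Blocked"
      using reaches_halts[OF start] pass by simp
    then have "halts ((?n - k) * (2 * ?n + 4) + 1) (scan w Start 0 (int k)) Blocked"
      by (rule halts_mono) (use bound in linarith)
    then show ?thesis using False k by auto
  next
    case True
    let ?q = "if \<forall>l. Suc k \<le> l \<and> l < ?n \<longrightarrow> windows_balanced w l then Free else Blocked"
    have "halts ((?n - Suc k) * (2 * ?n + 4) + 1) (scan w Start 0 (int (Suc k))) ?q"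
      using Suc.hyps by (intro Suc.hyps(1)) auto
    moreover have "reaches (?n - k + 2) (scan w Rewind (int (?n - k) - 1) (int ?n - 1))
        (scan w Start 0 (int (Suc k)))"
      using rewind[of "?n - k" w "int k"] k by (simp add: of_nat_diff add.commute)
    moreover have "reaches (Suc (?n - k)) (scan w Flat 0 (int k))
        (scan w Rewind (int (?n - k) - 1) (int ?n - 1))"
      using pass True by (simp only: if_True)
    ultimately have "halts (Suc 0 + (Suc (?n - k) + (?n - k + 2 + ((?n - Suc k) * (2 * ?n + 4) + 1))))
        (scan w Start 0 (int k)) ?q"
      using reaches_halts start by meson
    moreover have "(\<forall>l. Suc k \<le> l \<and> l < ?n \<longrightarrow> windows_balanced w l) \<longleftrightarrow>
        (\<forall>l. k \<le> l \<and> l < ?n \<longrightarrow> windows_balanced w l)"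
      using True by (metis Suc_leD not_less_eq_eq order_antisym)
    ultimately show ?thesis using halts_mono[OF _ bound] by simp
  qed
qed

lemma machine_halts:
  "halts (2 * length w ^ 2 + 6 * length w + 4) (initial_config machine w)
    (if (\<forall>x\<in>set w. inv_letter x \<notin> set w) \<and> balanced (map fst w) then Free else Blocked)"
proof -
  let ?n = "length w"
  have init: "initial_config machine w = config w (Copy {}) (\<lambda>_. Blank) 0 0"
    by (simp add: initial_config_def machine_def config_def)
  show ?thesis
  proof (cases "\<forall>x\<in>set w. inv_letter x \<notin> set w")
    case False
    then have "\<not> ((\<forall>x\<in>set w. inv_letter x \<notin> set w) \<and> balanced (map fst w))" by blast
    then show ?thesis
      unfolding init using halts_mono[OF copy_inconsistent[OF False]] by (simp only: if_False)
  next
    case True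
    \<comment> \<open>Copying ends with both heads at the same place, so the first rewind sets the
      window length to 1.\<close>
    have "reaches (?n + 2) (scan w Rewind (int ?n - 1) (int ?n - 1)) (scan w Start 0 (int 1))"
      using rewind[of ?n w 0] by simp
    from reaches_halts[OF this scan_phase[of 1 w]]
    have "halts (?n + 2 + ((?n - 1) * (2 * ?n + 4) + 1)) (scan w Rewind (int ?n - 1) (int ?n - 1))
        (if \<forall>l. 1 \<le> l \<and> l < ?n \<longrightarrow> windows_balanced w l then Free else Blocked)"
      by simp
    then have "halts (?n + 1 + (?n + 2 + ((?n - 1) * (2 * ?n + 4) + 1))) (initial_config machine w)
        (if \<forall>l. 1 \<le> l \<and> l < ?n \<longrightarrow> windows_balanced w l then Free else Blocked)"
      unfolding init by (rule reaches_halts[OF copy_consistent[OF True]])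
    \<comment> \<open>For nonempty input the left side is \<open>2 * ?n ^ 2 + 4 * ?n\<close>; for
      the empty word it is 4, the constant term of the bound.\<close>
    moreover have "?n + 1 + (?n + 2 + ((?n - 1) * (2 * ?n + 4) + 1)) \<le> 2 * ?n ^ 2 + 6 * ?n + 4"
      by (cases ?n) (auto simp: power2_eq_square algebra_simps)
    ultimately show ?thesis
      using True halts_mono unfolding balanced_iff_windows by auto
  qed
qed

theorem theorem5p5:
  shows "\<exists>(M :: letter tm) (T :: nat \<Rightarrow> nat).
    wf_tm M \<and> decides_in_time M (carrier F2) primitivity_blocking T \<and>
    (\<lambda>n. real (T n)) \<in> O(\<lambda>n. real n ^ 2)"
proof (intro exI[of _ machine] exI[of _ "\<lambda>n. 2 * n ^ 2 + 6 * n + 4"] conjI)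
  show "wf_tm machine" by (rule wf_machine)
  show "decides_in_time machine (carrier F2) primitivity_blocking (\<lambda>n. 2 * n ^ 2 + 6 * n + 4)"
    unfolding decides_in_time_def
  proof
    fix w
    have "(if primitivity_blocking w then accept_state machine else reject_state machine) =
        to_nat (if (\<forall>x\<in>set w. inv_letter x \<notin> set w) \<and> balanced (map fst w) then Free else Blocked)"
      by (simp add: machine_def primitivity_blocking_iff)
    then show "\<exists>t\<le>2 * length w ^ 2 + 6 * length w + 4.
        fst ((step machine ^^ t) (initial_config machine w)) =
        (if primitivity_blocking w then accept_state machine else reject_state machine)"
      using machine_halts[of w] unfolding halts_def by simp
  qed
  show "(\<lambda>n. real (2 * n ^ 2 + 6 * n + 4)) \<in> O(\<lambda>n. real n ^ 2)"
  \<comment> \<open>The factor is \<open>2 + 6 + 4\<close>, since \<open>n\<close> and 1 are at most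
    \<open>n ^ 2\<close> from \<open>n = 1\<close> on.\<close>
  proof (rule bigoI[of _ 12], rule eventually_sequentiallyI[of 1])
    fix n :: nat assume "1 \<le> n"
    then have "n \<le> n ^ 2" "1 \<le> n ^ 2" by (simp_all add: power2_eq_square)
    then have "2 * n ^ 2 + 6 * n + 4 \<le> 12 * n ^ 2" by linarith
    then have "real (2 * n ^ 2 + 6 * n + 4) \<le> real (12 * n ^ 2)" by (rule of_nat_mono)
    then show "norm (real (2 * n ^ 2 + 6 * n + 4)) \<le> 12 * norm (real n ^ 2)" by simp
  qed
qed

end
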